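(* Let $\mathfrak{p}$ be a prime of $A$ of degree $d$, let $\zeta\in\mathbb{F}_q^{\mathrm{alg}}$ be a root of $\mathfrak{p}$, and let $\vartheta_{\mathfrak{p}}$ be the associated Teichm\"uller character. Then $$g(\vartheta_{\mathfrak{p}}^{q^j})=\mathfrak{p}'(\zeta)^{-q^j}\,\omega(\zeta^{q^j}),\qquad j=0,\ldots,d-1,$$ where $\mathfrak{p}'$ denotes the derivative of $\mathfrak{p}$ with respect to $\theta$.
   Context: Let $q$ be a prime power, $A=\mathbb{F}_q[\theta]$, $K=\mathbb{F}_q(\theta)$, $K_\infty=\mathbb{F}_q((\theta^{-1}))$, $\mathbb{C}_\infty$ the completion of an algebraic closure of $K_\infty$, with absolute value $|\cdot|$, $|\theta|=q$; $\mathbb{F}_q^{\mathrm{alg}}$ is the algebraic closure of $\mathbb{F}_q$ in $\mathbb{C}_\infty$. A prime of $A$ is a monic irreducible polynomial. For $a\in A$ and $\xi\in\mathbb{C}_\infty$, $a(\xi)$ denotes the value of $a$ under the substitution $\theta\mapsto\xi$. Carlitz's exponential is $\exp(z)=\sum_{n\ge 0}z^{q^n}/d_n$, where $d_0=1$, $d_n=\prod_{i=0}^{n-1}(\theta^{q^n}-\theta^{q^i})$. Fix a $(q-1)$-th root $(-\theta)^{1/(q-1)}\in\mathbb{C}_\infty$ and set $\widetilde{\pi}=\theta(-\theta)^{1/(q-1)}\prod_{i\ge1}(1-\theta^{1-q^i})^{-1}$ (so $\ker\exp=\widetilde{\pi}A$) and, with the same root, $$\omega(t)=(-\theta)^{1/(q-1)}\prod_{i\ge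 0}\left(1-\frac{t}{\theta^{q^i}}\right)^{-1}\quad(|t|\le 1).$$ Carlitz's module is the $\mathbb{F}_q$-algebra homomorphism $a\mapsto\phi_a$ from $A$ to the $\mathbb{F}_q$-linear endomorphisms of $\mathbb{C}_\infty$ with $\phi_\theta(c)=\theta c+c^q$. For a prime $\mathfrak{p}$ of degree $d$ put $\lambda_{\mathfrak{p}}=\exp(\widetilde{\pi}/\mathfrak{p})$, a generator of the $A$-module $\ker\phi_{\mathfrak{p}}$, and $\Delta_{\mathfrak{p}}=\mathrm{Gal}(K(\lambda_{\mathfrak{p}})/K)$. There is a unique isomorphism $(A/\mathfrak{p}A)^\times\to\Delta_{\mathfrak{p}}$, $a\mapsto\sigma_a$, with $\sigma_a(\lambda_{\mathfrak{p}})=\phi_a(\lambda_{\mathfrak{p}})$. Given a root $\zeta$ of $\mathfrak{p}$, the Teichm\"uller character $\vartheta_{\mathfrak{p}}:\Delta_{\mathfrak{p}}\to(\mathbb{F}_q^{\mathrm{alg}})^\times$ is $\vartheta_{\mathfrak{p}}(\sigma_a)=a(\zeta)$. The basic Gauss-Thakur sums are $$g(\vartheta_{\mathfrak{p}}^{q^j})=-\sum_{\delta\in\Delta_{\mathfrak{p}}}\vartheta_{\mathfrak{p}}(\delta^{-1})^{q^j}\,\delta(\lambda_{\mathfrak{p}}),\qquad j=0,\ldots,d-1.$$ *)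

theory Defs
  imports
    "HOL-Analysis.Infinite_Products"
    "HOL-Algebra.Algebraic_Closure_Type"
    "HOL-Algebra.Generated_Fields"
    "HOL-Algebra.Bij"
    "HOL-Computational_Algebra.Formal_Laurent_Series"
begin

text \<open>
  The finite field is the type \<open>'q\<close>, with \<open>q = CARD('q)\<close>, and \<open>A\<close> is the type \<open>'q poly\<close>.
  The field \<open>K\<^sub>\<infinity>\<close> of Laurent series in \<open>1/\<theta>\<close> is \<open>'q fls\<close>, whose variable \<open>fls_X\<close> takes
  the place of \<open>1/\<theta>\<close>; thus \<open>\<theta>\<close> is \<open>fls_X_inv\<close> and \<open>\<bar>f\<bar> = q powi (- fls_subdegree f)\<close>.

  The following locale says that the valued field \<open>'c\<close>, with absolute value \<open>\<bar>x\<bar> = dist x 0\<close>,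
  is a completion of an algebraic closure \<open>L\<close> of \<open>K\<^sub>\<infinity>\<close>, where \<open>K\<^sub>\<infinity>\<close> is embedded
  isometrically by \<open>\<iota>\<close>. Completeness is part of the sort of \<open>'c\<close>. The library's normed fields
  cannot be used since they are real algebras.
\<close>

locale C_infty =
  fixes \<iota> :: "'q::{field,finite} fls \<Rightarrow> 'c::{field,complete_space}"
  assumes dist_add: "dist (x + z) (y + z) = dist x (y :: 'c)"
    and dist_mult_0: "dist (x * y) 0 = dist x 0 * dist y (0 :: 'c)"
    and dist_ultrametric: "dist x z \<le> max (dist x y) (dist y (z :: 'c))"
    and embed_1: "\<iota> 1 = 1"
    and embed_add: "\<iota> (f + g) = \<iota> f + \<iota> g"
    and embed_mult: "\<iota> (f * g) = \<iota> f * \<iota> g"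
    and dist_embed: "f \<noteq> 0 \<Longrightarrow> dist (\<iota> f) 0 = real CARD('q) powi (- fls_subdegree f)"
    and dense_alg_closure:
      "\<exists>L. algebraic_closure ((ring_of_type_algebra :: 'c ring)\<lparr>carrier := L\<rparr>) (range \<iota>) \<and>
           closure L = UNIV"

definition theta :: "('q::{field,finite} fls \<Rightarrow> 'c::{field,complete_space}) \<Rightarrow> 'c" where
  "theta \<iota> = \<iota> fls_X_inv"

definition value_at ::
    "('q::{field,finite} fls \<Rightarrow> 'c::{field,complete_space}) \<Rightarrow> 'q poly \<Rightarrow> 'c \<Rightarrow> 'c" where
  "value_at \<iota> a \<xi> = poly (map_poly (\<lambda>c. \<iota> (fls_const c)) a) \<xi>"

definition Fq_alg :: "('q::{field,finite} fls \<Rightarrow> 'c::{field,complete_space}) \<Rightarrow> 'c set" where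
  "Fq_alg \<iota> = {\<xi>. \<exists>a. a \<noteq> 0 \<and> value_at \<iota> a \<xi> = 0}"

definition K_rat :: "('q::{field,finite} fls \<Rightarrow> 'c::{field,complete_space}) \<Rightarrow> 'c set" where
  "K_rat \<iota> = {value_at \<iota> a (theta \<iota>) / value_at \<iota> b (theta \<iota>) | a b. b \<noteq> 0}"

definition prime_of_A :: "'q::{field,finite} poly \<Rightarrow> bool" where
  "prime_of_A p \<longleftrightarrow> lead_coeff p = 1 \<and> Factorial_Ring.irreducible p"

definition carlitz_d ::
    "('q::{field,finite} fls \<Rightarrow> 'c::{field,complete_space}) \<Rightarrow> nat \<Rightarrow> 'c" where
  "carlitz_d \<iota> n = (\<Prod>i<n. theta \<iota> ^ (CARD('q) ^ n) - theta \<iota> ^ (CARD('q) ^ i))"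

definition carlitz_exp ::
    "('q::{field,finite} fls \<Rightarrow> 'c::{field,complete_space}) \<Rightarrow> 'c \<Rightarrow> 'c" where
  "carlitz_exp \<iota> z = (\<Sum>n. z ^ (CARD('q) ^ n) / carlitz_d \<iota> n)"

text \<open>In the next definitions \<open>\<rho>\<close> is the chosen \<open>(q - 1)\<close>-th root of \<open>- \<theta>\<close>.
  The factors of the first product are those with exponents \<open>1 - q\<^sup>i\<close>, \<open>i \<ge> 1\<close>.\<close>

definition pi_tilde ::
    "('q::{field,finite} fls \<Rightarrow> 'c::{field,complete_space}) \<Rightarrow> 'c \<Rightarrow> 'c" where
  "pi_tilde \<iota> \<rho> =
     theta \<iota> * \<rho> * (\<Prod>i. inverse (1 - theta \<iota> powi (1 - int CARD('q) ^ Suc i)))"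

definition omega ::
    "('q::{field,finite} fls \<Rightarrow> 'c::{field,complete_space}) \<Rightarrow> 'c \<Rightarrow> 'c \<Rightarrow> 'c" where
  "omega \<iota> \<rho> t = \<rho> * (\<Prod>i. inverse (1 - t / theta \<iota> ^ (CARD('q) ^ i)))"

text \<open>The \<open>\<bbbF>\<^sub>q\<close>-algebra homomorphism \<open>a \<mapsto> \<phi>\<^sub>a\<close> is determined by \<open>\<phi>\<^sub>\<theta>\<close>: it maps
  \<open>\<Sum>\<^sub>i a\<^sub>i \<theta>\<^sup>i\<close> to \<open>\<Sum>\<^sub>i a\<^sub>i \<phi>\<^sub>\<theta>\<^sup>i\<close>, powers being compositions.\<close>

definition carlitz_module ::
    "('q::{field,finite} fls \<Rightarrow> 'c::{field,complete_space}) \<Rightarrow> 'q poly \<Rightarrow> 'c \<Rightarrow> 'c" where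
  "carlitz_module \<iota> a c =
     (\<Sum>i\<le>Polynomial.degree a. \<iota> (fls_const (Polynomial.coeff a i)) *
        ((\<lambda>x. theta \<iota> * x + x ^ CARD('q)) ^^ i) c)"

definition lambda_p ::
    "('q::{field,finite} fls \<Rightarrow> 'c::{field,complete_space}) \<Rightarrow> 'c \<Rightarrow> 'q poly \<Rightarrow> 'c" where
  "lambda_p \<iota> \<rho> p = carlitz_exp \<iota> (pi_tilde \<iota> \<rho> / value_at \<iota> p (theta \<iota>))"

definition galois_group :: "'c::field set \<Rightarrow> 'c set \<Rightarrow> ('c \<Rightarrow> 'c) monoid" where
  "galois_group k L =
     (let R = (ring_of_type_algebra :: 'c ring)\<lparr>carrier := L\<rparr> in
      (BijGroup L)\<lparr>carrier := {\<sigma> \<in> Bij L. \<sigma> \<in> ring_hom R R \<and> (\<forall>x\<in>k. \<sigma> x = x)}\<rparr>)"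

definition Delta_p ::
    "('q::{field,finite} fls \<Rightarrow> 'c::{field,complete_space}) \<Rightarrow> 'c \<Rightarrow> 'q poly \<Rightarrow> ('c \<Rightarrow> 'c) monoid" where
  "Delta_p \<iota> \<rho> p =
     galois_group (K_rat \<iota>)
       (generate_field ring_of_type_algebra (K_rat \<iota> \<union> {lambda_p \<iota> \<rho> p}))"

text \<open>The automorphism \<open>\<sigma>\<^sub>a\<close>, for \<open>a\<close> representing a unit modulo \<open>p\<close>.\<close>

definition sigma_p ::
    "('q::{field,finite} fls \<Rightarrow> 'c::{field,complete_space}) \<Rightarrow> 'c \<Rightarrow> 'q poly \<Rightarrow> 'q poly \<Rightarrow> 'c \<Rightarrow> 'c" where
  "sigma_p \<iota> \<rho> p a =
     (THE \<sigma>. \<sigma> \<in> carrier (Delta_p \<iota> \<rho> p) \<and>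
             \<sigma> (lambda_p \<iota> \<rho> p) = carlitz_module \<iota> a (lambda_p \<iota> \<rho> p))"

definition teichmueller ::
    "('q::{field,finite} fls \<Rightarrow> 'c::{field,complete_space}) \<Rightarrow> 'c \<Rightarrow> 'q poly \<Rightarrow> 'c \<Rightarrow> ('c \<Rightarrow> 'c) \<Rightarrow> 'c" where
  "teichmueller \<iota> \<rho> p \<zeta> \<delta> =
     (THE x. \<exists>a. coprime a p \<and> \<delta> = sigma_p \<iota> \<rho> p a \<and> x = value_at \<iota> a \<zeta>)"

definition gauss_thakur ::
    "('q::{field,finite} fls \<Rightarrow> 'c::{field,complete_space}) \<Rightarrow> 'c \<Rightarrow> 'q poly \<Rightarrow> (('c \<Rightarrow> 'c) \<Rightarrow> 'c) \<Rightarrow> 'c" where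
  "gauss_thakur \<iota> \<rho> p \<psi> =
     - (\<Sum>\<delta> \<in> carrier (Delta_p \<iota> \<rho> p). \<psi> (inv\<^bsub>Delta_p \<iota> \<rho> p\<^esub> \<delta>) * \<delta> (lambda_p \<iota> \<rho> p))"

end

theory Submission
  imports Defs
begin

text \<open>
  Let \<open>d\<close> be the degree of \<open>p\<close>, let \<open>W = \<bbbF>\<^sub>q[\<zeta>]\<close> be the residue field at \<open>p\<close>, a field with \<open>q\<^sup>d\<close>
  elements, and write \<open>\<zeta>\<^sub>k\<close> for the conjugate \<open>\<zeta> ^ (q ^ k)\<close>. The whole proof rests on an
  explicit formula for the \<open>p\<close>-torsion of Carlitz's module: for \<open>x\<close> in \<open>W\<close> put
  \<open>M(x) = \<Sum>k<d. (x / p'(\<zeta>)) ^ (q ^ k) * \<omega>(\<zeta>\<^sub>k)\<close>.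
  Then the generator is \<open>\<lambda>\<^sub>p = M(1)\<close>, and \<open>\<phi>\<^sub>a (M x) = M (a(\<zeta>) x)\<close> for all \<open>a\<close>. Hence the conjugates of \<open>\<lambda>\<^sub>p\<close>
  are the \<open>M(x)\<close> for \<open>x\<close> in \<open>W - {0}\<close>, the Teichmueller character sends the automorphism that takes
  \<open>\<lambda>\<^sub>p\<close> to \<open>M(x)\<close> to \<open>x\<close>, and the Gauss-Thakur sum is minus the sum over these \<open>x\<close> of \<open>M(x) / x ^ (q ^ j)\<close>.
  By orthogonality of the characters \<open>x \<mapsto> x ^ (q ^ k)\<close> of \<open>W - {0}\<close>, only the term \<open>k = j\<close> of
  \<open>M\<close> survives (\<open>torsion_transform\<close>), and this term is the right-hand side of the theorem.

  The formula \<open>\<lambda>\<^sub>p = M(1)\<close> (\<open>lambda_eq_torsion\<close>) is a comparison of two partial fraction expansions.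
  A partial product of \<open>\<omega>(t)\<close> is a rational function of \<open>t\<close> with simple poles at \<open>\<theta> ^ (q ^ n)\<close>. Up to sign,
  its residues converge to the coefficients \<open>\<pi> ^ (q ^ n) / d\<^sub>n\<close> of \<open>exp(\<pi> z)\<close>, where \<open>\<pi>\<close> is the period, uniformly enough
  (\<open>exp_term_close\<close>) that \<open>exp(\<pi> y)\<close> is the limit of the sums of residues times powers of \<open>y\<close>. For
  \<open>y = 1/p(\<theta>)\<close> these powers are the values of \<open>1/p\<close> at the poles, which expand in partial fractions
  with poles at the \<open>\<zeta>\<^sub>k\<close>; exchanging the two finite sums gives partial products of \<open>\<omega>(\<zeta>\<^sub>k)\<close>. The action of
  \<open>\<phi>\<close> follows from the functional equation \<open>\<omega>(t)\<^sup>q = (t\<^sup>q - \<theta>) \<omega>(t\<^sup>q)\<close> (\<open>omega_frob\<close>), which shifts the sum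
  that defines \<open>M\<close> cyclically.

  That every \<open>x\<close> in \<open>W - {0}\<close> does come from an automorphism is the irreducibility of \<open>\<phi>\<^sub>p(X)/X\<close> over \<open>K\<close>,
  which is an Eisenstein polynomial at \<open>p\<close> (\<open>torsion_poly_minimal\<close>). It is used in the form that a
  polynomial over \<open>A\<close> which vanishes at \<open>\<lambda>\<^sub>p\<close> vanishes at all \<open>M(x)\<close> (\<open>torsion_root_transfer\<close>), so that
  \<open>f(\<lambda>\<^sub>p)/g(\<lambda>\<^sub>p) \<mapsto> f(M x)/g(M x)\<close> is a well-defined automorphism.
\<close>

section \<open>Finite fields, Frobenius and partial fractions\<close>

text \<open>
  Multiplication by \<open>x\<close> permutes \<open>S\<close>, so it does not change the product of the elements of \<open>S\<close>. The
  lemma is applied to the units of \<open>\<bbbF>\<^sub>q\<close> and to those of its extension by \<open>\<zeta>\<close>.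
\<close>

lemma power_card_eq_1:
  fixes S :: "'a::field set"
  assumes S: "finite S" "0 \<notin> S" "\<And>x y. x \<in> S \<Longrightarrow> y \<in> S \<Longrightarrow> x * y \<in> S" and x: "x \<in> S"
  shows "x ^ card S = 1"
proof -
  have inj: "inj_on ((*) x) S"
    using S x by (auto intro!: inj_onI)
  have "(*) x ` S = S"
    by (rule endo_inj_surj) (use S x inj in auto)
  then have "\<Prod>S = (\<Prod>y\<in>S. x * y)"
    using prod.reindex[OF inj, of "\<lambda>y. y"] by simp
  also have "\<dots> = x ^ card S * \<Prod>S"
    by (simp add: prod.distrib)
  finally show ?thesis
    using S by (auto simp: prod_zero_iff)
qed

lemma finite_field_power_CARD:
  fixes c :: "'q::{field,finite}"
  shows "c ^ CARD('q) = c"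
proof (cases "c = 0")
  case False
  have "c ^ card (UNIV - {0 :: 'q}) = 1"
    using False by (intro power_card_eq_1) auto
  then have "c ^ (CARD('q) - 1) * c = c"
    by (simp add: card_Diff_singleton)
  then show ?thesis
    by (metis power_minus_mult zero_less_card_finite)
qed simp

text \<open>
  The reason that the \<open>q\<close>-th power is additive. The polynomial
  \<open>(X + 1)\<^sup>q - X\<^sup>q - 1\<close> has degree less than \<open>q\<close> and vanishes on all of \<open>\<bbbF>\<^sub>q\<close>, so it is zero.
\<close>

lemma of_nat_CARD_choose_eq_0:
  assumes "0 < k" "k < CARD('q::{field,finite})"
  shows "(of_nat (CARD('q) choose k) :: 'q) = 0"
proof -
  define f :: "'q poly" where
    "f = (\<Sum>i\<in>{0<..<CARD('q)}. monom (of_nat (CARD('q) choose i)) i)"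
  have "poly f c = 0" for c
  proof -
    have "(c + 1) ^ CARD('q) = (\<Sum>i\<le>CARD('q). of_nat (CARD('q) choose i) * c ^ i)"
      by (simp add: binomial_ring)
    also have "{..CARD('q)} = insert 0 (insert CARD('q) {0<..<CARD('q)})"
      by auto
    finally have "c + 1 = 1 + (c + poly f c)"
      by (simp add: finite_field_power_CARD f_def poly_sum poly_monom)
    then show ?thesis
      by simp
  qed
  moreover have "degree f < CARD('q)"
    unfolding f_def by (rule degree_sum_less) (auto intro: le_less_trans[OF degree_monom_le])
  ultimately have "f = 0"
    using card_poly_roots_bound[of f] by fastforce
  moreover have "coeff f k = of_nat (CARD('q) choose k)"
    using assms by (simp add: f_def coeff_sum coeff_monom if_distrib cong: if_cong)
  ultimately show ?thesis
    by simp
qed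

text \<open>
  Integral domains over \<open>\<bbbF>\<^sub>q\<close>. The two instances are the valued field, where Frobenius acts on torsion
  points, and \<open>A\<close>, where it acts on the coefficients of Carlitz's module.
\<close>

locale finite_field_algebra =
  fixes h :: "'q::{field,finite} \<Rightarrow> 'b::idom"
  assumes h_1: "h 1 = 1" and h_add: "h (x + y) = h x + h y" and h_mult: "h (x * y) = h x * h y"
begin

lemma h_0: "h 0 = 0"
  by (metis add_0 add_cancel_right_right h_add)

lemma h_of_nat: "h (of_nat n) = of_nat n"
  by (induction n) (auto simp: h_0 h_1 h_add)

lemma h_power: "h (x ^ n) = h x ^ n"
  by (induction n) (auto simp: h_1 h_mult)

lemma h_frob [simp]: "h c ^ CARD('q) = h c"
  by (simp add: finite_field_power_CARD flip: h_power)

lemma frob_add: "(x + y) ^ CARD('q) = x ^ CARD('q) + (y :: 'b) ^ CARD('q)"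
proof -
  have "(x + y) ^ CARD('q) = (\<Sum>i\<le>CARD('q). of_nat (CARD('q) choose i) * x ^ i * y ^ (CARD('q) - i))"
    by (rule binomial_ring)
  also have "\<dots> = (\<Sum>i\<in>{0, CARD('q)}. of_nat (CARD('q) choose i) * x ^ i * y ^ (CARD('q) - i))"
  proof (intro sum.mono_neutral_right ballI)
    fix i assume "i \<in> {..CARD('q)} - {0, CARD('q)}"
    then have "of_nat (CARD('q) choose i) = (0 :: 'q)"
      by (intro of_nat_CARD_choose_eq_0) auto
    then have "of_nat (CARD('q) choose i) = (0 :: 'b)"
      using h_of_nat[of "CARD('q) choose i"] by (simp add: h_0)
    then show "of_nat (CARD('q) choose i) * x ^ i * y ^ (CARD('q) - i) = 0"
      by simp
  qed auto
  finally show ?thesis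
    by (simp add: add_ac)
qed

lemma frob_power_add: "(x + y) ^ (CARD('q) ^ n) = x ^ (CARD('q) ^ n) + (y :: 'b) ^ (CARD('q) ^ n)"
proof (induction n)
  case (Suc n)
  have "(x + y) ^ (CARD('q) ^ Suc n) = ((x + y) ^ (CARD('q) ^ n)) ^ CARD('q)"
    by (simp add: mult.commute flip: power_mult)
  then show ?case
    by (simp add: Suc frob_add mult.commute flip: power_mult)
qed simp

lemma frob_power_diff: "(x - y) ^ (CARD('q) ^ n) = x ^ (CARD('q) ^ n) - (y :: 'b) ^ (CARD('q) ^ n)"
  using frob_power_add[of "x - y" y n] by (simp add: algebra_simps)

lemma frob_power_uminus: "(- x) ^ (CARD('q) ^ n) = - ((x :: 'b) ^ (CARD('q) ^ n))"
  using frob_power_diff[of 0 x n] by (simp add: power_0_left)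

lemma frob_power_sum: "(\<Sum>i\<in>I. f i) ^ (CARD('q) ^ n) = (\<Sum>i\<in>I. (f i :: 'b) ^ (CARD('q) ^ n))"
  by (induction I rule: infinite_finite_induct) (auto simp: frob_power_add power_0_left)

lemma frob_power_inj: "x ^ (CARD('q) ^ n) = y ^ (CARD('q) ^ n) \<longleftrightarrow> x = (y :: 'b)"
  using frob_power_diff[of x y n] by auto

lemma h_frob_power [simp]: "h c ^ (CARD('q) ^ n) = h c"
  by (induction n) (auto simp: power_mult)

lemma CARD_eq_0: "(of_nat CARD('q) :: 'b) = 0"
proof -
  have "of_nat CARD('q) = (0 :: 'q)"
  proof -
    have "(\<Sum>x\<in>UNIV. x + 1 :: 'q) = (\<Sum>x\<in>UNIV. x)"
      by (rule sum.reindex_bij_witness[of _ "\<lambda>x. x - 1" "\<lambda>x. x + 1"]) auto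
    then show ?thesis
      by (simp add: sum.distrib)
  qed
  then show ?thesis
    using h_of_nat[of "CARD('q)"] by (simp add: h_0)
qed

end

text \<open>
  Partial fractions of the inverse of a product of distinct linear factors. The same lemma expands
  the partial products of omega and the function \<open>1/p\<close>.
\<close>

lemma inverse_prod_diff_partial_fractions:
  fixes z :: "'i \<Rightarrow> 'a::field"
  assumes "finite I" "I \<noteq> {}" "inj_on z I" "x \<notin> z ` I"
  shows "inverse (\<Prod>i\<in>I. x - z i) = (\<Sum>i\<in>I. inverse (x - z i) * inverse (\<Prod>j\<in>I - {i}. z i - z j))"
  using assms
proof (induction I arbitrary: x rule: finite_ne_induct)
  case (insert k F)
  define w where "w i = inverse (\<Prod>j\<in>F - {i}. z i - z j)" for i
  have x: "x - z i \<noteq> 0" "z k - z i \<noteq> 0" "i \<noteq> k" if "i \<in> F" for i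
    using insert that by (auto simp: inj_on_def)
  have xk: "x - z k \<noteq> 0"
    using insert by auto
  have IH: "inverse (\<Prod>i\<in>F. y - z i) = (\<Sum>i\<in>F. inverse (y - z i) * w i)" if "y \<notin> z ` F" for y
    using insert that by (auto simp: w_def)
  have prod_insert: "inverse (\<Prod>j\<in>insert k F - {i}. z i - z j) = inverse (z i - z k) * w i" if "i \<in> F" for i
  proof -
    have "insert k F - {i} = insert k (F - {i})"
      using x[OF that] by auto
    then show ?thesis
      using insert by (simp add: w_def)
  qed
  have "inverse (\<Prod>i\<in>insert k F. x - z i) = inverse (x - z k) * (\<Sum>i\<in>F. inverse (x - z i) * w i)"
    using insert IH[of x] by simp
  also have "\<dots> = (\<Sum>i\<in>F. inverse (x - z k) * (inverse (z k - z i) * w i)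
                        + inverse (x - z i) * (inverse (z i - z k) * w i))"
    unfolding sum_distrib_left
  proof (rule sum.cong[OF refl])
    fix i assume i: "i \<in> F"
    \<comment> \<open>Splitting off the new pole: the identity for two linear factors.\<close>
    have split: "inverse b * inverse a = inverse b * inverse c + inverse a * inverse (- c)"
      if "a \<noteq> 0" "b \<noteq> 0" "c \<noteq> 0" "a = b + c" for a b c :: 'a
    proof -
      have *: "inverse b - inverse a = c * (inverse b * inverse a)"
        using that by (simp add: division_ring_inverse_diff)
      have "inverse b * inverse a = inverse c * (inverse b - inverse a)"
        unfolding * mult.assoc[symmetric] using \<open>c \<noteq> 0\<close> by simp
      also have "\<dots> = inverse b * inverse c + inverse a * inverse (- c)"
        by (simp add: algebra_simps)
      finally show ?thesis .
    qed
    have "z i - z k = - (z k - z i)"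
      by simp
    then have "inverse (x - z k) * inverse (x - z i) =
        inverse (x - z k) * inverse (z k - z i) + inverse (x - z i) * inverse (z i - z k)"
      by (simp only:) (rule split, use x[OF i] xk in auto)
    then show "inverse (x - z k) * (inverse (x - z i) * w i) =
        inverse (x - z k) * (inverse (z k - z i) * w i) + inverse (x - z i) * (inverse (z i - z k) * w i)"
      by (simp only: mult.assoc[symmetric] distrib_right[symmetric])
  qed
  also have "\<dots> = inverse (x - z k) * inverse (\<Prod>j\<in>F. z k - z j)
                 + (\<Sum>i\<in>F. inverse (x - z i) * (inverse (z i - z k) * w i))"
  proof -
    have "z k \<notin> z ` F"
      using x by force
    then show ?thesis
      by (simp add: IH sum.distrib sum_distrib_left)
  qed
  also have "(\<Sum>i\<in>F. inverse (x - z i) * (inverse (z i - z k) * w i)) =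
             (\<Sum>i\<in>F. inverse (x - z i) * inverse (\<Prod>j\<in>insert k F - {i}. z i - z j))"
    using prod_insert by auto
  finally show ?case
    using insert by simp
qed simp

text \<open>
  Evaluation of polynomials whose coefficients are mapped by a ring homomorphism: polynomials over
  \<open>\<bbbF>\<^sub>q\<close> at a point of the valued field, and polynomials over \<open>A\<close>, with \<open>\<theta>\<close> substituted in the coefficients.
\<close>

locale ring_hom_eval =
  fixes h :: "'a::comm_ring_1 \<Rightarrow> 'b::comm_ring_1"
  assumes hom_1: "h 1 = 1" and hom_add: "h (x + y) = h x + h y" and hom_mult: "h (x * y) = h x * h y"
begin

lemma hom_0: "h 0 = 0"
  using hom_add[of 0 0] by simp

definition ev :: "'a poly \<Rightarrow> 'b \<Rightarrow> 'b" where
  "ev f x = poly (map_poly h f) x"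

lemma ev_0 [simp]: "ev 0 x = 0"
  by (simp add: ev_def)

lemma ev_pCons [simp]: "ev (pCons a f) x = h a + x * ev f x"
  by (simp add: ev_def map_poly_pCons hom_0)

lemma ev_1 [simp]: "ev 1 x = 1"
  by (simp add: one_pCons hom_1)

lemma ev_add: "ev (f + g) x = ev f x + ev g x"
proof (induction f arbitrary: g)
  case (pCons a f)
  then show ?case by (cases g) (simp add: hom_add algebra_simps)
qed simp

lemma ev_smult: "ev (smult c f) x = h c * ev f x"
  by (induction f) (simp_all add: hom_mult algebra_simps)

lemma ev_mult: "ev (f * g) x = ev f x * ev g x"
  by (induction f) (simp_all add: ev_add ev_smult hom_0 algebra_simps)

lemma ev_uminus: "ev (- f) x = - ev f x"
  using ev_add[of f "- f" x] by (simp add: eq_neg_iff_add_eq_0 add.commute)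

lemma ev_diff: "ev (f - g) x = ev f x - ev g x"
  using ev_add[of f "- g" x] by (simp add: ev_uminus)

lemma ev_power: "ev (f ^ n) x = ev f x ^ n"
  by (induction n) (auto simp: ev_mult)

lemma ev_sum: "ev (\<Sum>i\<in>I. f i) x = (\<Sum>i\<in>I. ev (f i) x)"
  by (induction I rule: infinite_finite_induct) (auto simp: ev_add)

lemma ev_monom: "ev (monom c n) x = h c * x ^ n"
  by (simp add: ev_def map_poly_monom hom_0 poly_monom)

lemma ev_altdef: "ev f x = (\<Sum>i\<le>degree f. h (coeff f i) * x ^ i)"
proof -
  have "ev f x = (\<Sum>i\<le>degree f. ev (monom (coeff f i) i) x)"
    by (subst poly_as_sum_of_monoms[of f, symmetric]) (simp add: ev_sum)
  then show ?thesis
    by (simp add: ev_monom)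
qed

end

section \<open>Limits and products in the valued field\<close>

context C_infty
begin

definition av :: "'c \<Rightarrow> real" where "av x = dist x 0"

definition const :: "'q \<Rightarrow> 'c" where "const c = \<iota> (fls_const c)"

abbreviation \<theta> :: 'c where "\<theta> \<equiv> theta \<iota>"

lemma CARD_ge_2: "CARD('q) \<ge> 2"
  using card_mono[of "UNIV :: 'q set" "{0, 1}"] by simp

lemma CARD_gt_1: "real CARD('q) > 1"
  using CARD_ge_2 by linarith

lemma dist_eq_av: "dist x y = av (x - y)"
  using dist_add[of "x - y" y 0] by (simp add: av_def)

lemma av_mult: "av (x * y) = av x * av y"
  by (simp add: av_def dist_mult_0)

lemma av_0 [simp]: "av 0 = 0" and av_eq_0_iff [simp]: "av x = 0 \<longleftrightarrow> x = 0" and av_nonneg [simp]: "av x \<ge> 0"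
  by (auto simp: av_def)

lemma av_1 [simp]: "av 1 = 1"
proof -
  have "av 1 * av 1 = av 1 * 1"
    by (simp flip: av_mult)
  then show ?thesis
    by (simp only: mult_cancel_left) auto
qed

lemma av_uminus [simp]: "av (- x) = av x"
proof -
  have "av (- x) ^ 2 = av x ^ 2"
    by (simp add: power2_eq_square flip: av_mult)
  then show ?thesis
    by (simp add: power2_eq_iff_nonneg)
qed

lemma av_diff_commute: "av (x - y) = av (y - x)"
  using av_uminus[of "x - y"] by simp

lemma av_add_le: "av (x + y) \<le> max (av x) (av y)"
  using dist_ultrametric[of x "- y" 0] by (simp add: dist_eq_av)

lemma av_diff_le: "av (x - y) \<le> max (av x) (av y)"
  using av_add_le[of x "- y"] by simp

lemma av_add_eq: "av y < av x \<Longrightarrow> av (x + y) = av x"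
  using av_add_le[of x y] av_diff_le[of "x + y" y] by (simp add: max_def split: if_splits)

lemma av_1_minus: "av y < 1 \<Longrightarrow> av (1 - y) = 1"
  using av_add_eq[of "- y" 1] by simp

lemma av_power: "av (x ^ n) = av x ^ n"
  by (induction n) (auto simp: av_mult)

lemma av_inverse: "av (inverse x) = inverse (av x)"
proof (cases "x = 0")
  case False
  then have "av x * av (inverse x) = 1"
    by (simp flip: av_mult)
  then show ?thesis
    by (simp add: inverse_unique)
qed simp

lemma av_divide: "av (x / y) = av x / av y"
  by (simp add: divide_inverse av_mult av_inverse)

lemma av_prod: "av (\<Prod>i\<in>I. f i) = (\<Prod>i\<in>I. av (f i))"
  by (induction I rule: infinite_finite_induct) (auto simp: av_mult)

lemma av_sum_le: "B \<ge> 0 \<Longrightarrow> (\<And>i. i \<in> I \<Longrightarrow> av (f i) \<le> B) \<Longrightarrow> av (\<Sum>i\<in>I. f i) \<le> B"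
proof (induction I rule: infinite_finite_induct)
  case (insert i I)
  have "av (sum f (insert i I)) \<le> max (av (f i)) (av (sum f I))"
    using insert av_add_le by simp
  with insert show ?case
    by fastforce
qed auto

lemma tendsto_iff_av: "(f \<longlongrightarrow> l) F \<longleftrightarrow> ((\<lambda>n. av (f n - l)) \<longlongrightarrow> 0) F"
  by (simp add: tendsto_dist_iff[of f] dist_eq_av)

lemma valued_tendsto_mult_left: "(f \<longlongrightarrow> (l :: 'c)) F \<Longrightarrow> ((\<lambda>n. c * f n) \<longlongrightarrow> c * l) F"
  unfolding tendsto_iff_av[of _ "c * l"] tendsto_iff_av[of f]
  by (auto simp: av_mult simp flip: right_diff_distrib intro: tendsto_eq_intros)

lemma valued_tendsto_add: "(f \<longlongrightarrow> l) F \<Longrightarrow> (g \<longlongrightarrow> m) F \<Longrightarrow> ((\<lambda>n. f n + g n) \<longlongrightarrow> l + (m :: 'c)) F"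
proof -
  assume "(f \<longlongrightarrow> l) F" "(g \<longlongrightarrow> m) F"
  then have "((\<lambda>n. max (av (f n - l)) (av (g n - m))) \<longlongrightarrow> max 0 0) F"
    unfolding tendsto_iff_av[of f] tendsto_iff_av[of g] by (rule tendsto_max)
  then have lim: "((\<lambda>n. max (av (f n - l)) (av (g n - m))) \<longlongrightarrow> 0) F"
    by simp
  have "av (f n + g n - (l + m)) \<le> max (av (f n - l)) (av (g n - m))" for n
    using av_add_le[of "f n - l" "g n - m"] by (simp add: algebra_simps)
  then have "((\<lambda>n. av (f n + g n - (l + m))) \<longlongrightarrow> 0) F"
    by (intro tendsto_sandwich[OF _ _ tendsto_const lim] always_eventually) auto
  then show "((\<lambda>n. f n + g n) \<longlongrightarrow> l + m) F"
    by (simp add: tendsto_iff_av[of _ "l + m"])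
qed

lemma valued_tendsto_sum: "(\<And>i. i \<in> I \<Longrightarrow> (f i \<longlongrightarrow> l i) F) \<Longrightarrow> ((\<lambda>n. \<Sum>i\<in>I. f i n) \<longlongrightarrow> (\<Sum>i\<in>I. l i :: 'c)) F"
  by (induction I rule: infinite_finite_induct) (auto intro!: valued_tendsto_add)

lemma LIMSEQ_bounded_dist:
  assumes "f \<longlonglongrightarrow> (P :: 'c)" "\<And>n. n \<ge> N \<Longrightarrow> av (f n - Y) \<le> B"
  shows "av (P - Y) \<le> B"
proof -
  have "(\<lambda>n. dist (f n) Y) \<longlonglongrightarrow> dist P Y"
    using assms by (intro tendsto_dist) auto
  then show ?thesis
    unfolding dist_eq_av by (rule LIMSEQ_le_const2) (use assms in auto)
qed

text \<open>
  Partial products of factors that tend to 1 geometrically have absolute value 1, and their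
  differences are dominated by the first omitted factor because of the ultrametric inequality.
\<close>

lemma prodinf_near_1:
  fixes u :: "nat \<Rightarrow> 'c"
  assumes u: "\<And>i. av (u i) \<le> 1 / real CARD('q) ^ Suc i"
  defines "P \<equiv> (\<Prod>i. inverse (1 - u i))"
  shows "(\<lambda>m. \<Prod>i<m. inverse (1 - u i)) \<longlonglongrightarrow> P"
    and "P \<noteq> 0"
    and "av (P - (\<Prod>i<m. inverse (1 - u i))) \<le> 1 / real CARD('q) ^ Suc m"
proof -
  define p where "p m = (\<Prod>i<m. inverse (1 - u i))" for m
  have u1: "av (u i) < 1" for i
  proof -
    have "1 / real CARD('q) ^ Suc i < 1"
      using CARD_gt_1 by (simp add: one_less_power del: power_Suc)
    with u[of i] show ?thesis
      by linarith
  qed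
  have u0: "1 - u i \<noteq> 0" for i
    using u1[of i] by auto
  have av_p: "av (p m) = 1" for m
    by (simp add: p_def av_prod av_inverse av_1_minus u1)
  have step: "av (p (Suc m) - p m) = av (u m)" for m
  proof -
    have "p (Suc m) - p m = p m * (u m * inverse (1 - u m))"
      using u0[of m] by (simp add: p_def field_simps)
    then show ?thesis
      by (simp add: av_mult av_p av_inverse av_1_minus u1)
  qed
  have near: "av (p n - p m) \<le> 1 / real CARD('q) ^ Suc m" if "n \<ge> m" for n m
    using that
  proof (induction n rule: dec_induct)
    case (step n)
    have "av (p (Suc n) - p n) \<le> 1 / real CARD('q) ^ Suc n"
      using \<open>av (p (Suc n) - p n) = av (u n)\<close> u by simp
    also have "\<dots> \<le> 1 / real CARD('q) ^ Suc m"
      using step CARD_gt_1 by (intro divide_left_mono power_increasing) auto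
    finally show ?case
      using step.IH av_add_le[of "p (Suc n) - p n" "p n - p m"] by simp
  qed (use CARD_gt_1 in simp)
  have lim0: "(\<lambda>m. 1 / real CARD('q) ^ Suc m) \<longlonglongrightarrow> 0"
    using LIMSEQ_inverse_realpow_zero[OF CARD_gt_1, THEN LIMSEQ_Suc] by (simp add: inverse_eq_divide)
  have "Cauchy p"
  proof (rule metric_CauchyI)
    fix e :: real assume "e > 0"
    then obtain M where M: "1 / real CARD('q) ^ Suc M < e"
      using order_tendstoD(2)[OF lim0, of e] unfolding eventually_sequentially by auto
    show "\<exists>M. \<forall>m\<ge>M. \<forall>n\<ge>M. dist (p m) (p n) < e"
    proof (intro exI allI impI)
      fix m n assume "M \<le> m" "M \<le> n"
      then have "av (p m - p M) < e" "av (p M - p n) < e"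
        using near[of M m] near[of M n] M by (auto simp: av_diff_commute[of "p M"])
      then show "dist (p m) (p n) < e"
        using av_add_le[of "p m - p M" "p M - p n"] by (simp add: dist_eq_av)
    qed
  qed
  then obtain P' where P': "p \<longlonglongrightarrow> P'"
    by (auto simp: Cauchy_convergent_iff convergent_def)
  have near': "av (P' - p m) \<le> 1 / real CARD('q) ^ Suc m" for m
    using P' near by (rule LIMSEQ_bounded_dist)
  have "P' \<noteq> 0"
    using near'[of 0] av_p[of 0] CARD_gt_1 by auto
  moreover from this have "raw_has_prod (\<lambda>i. inverse (1 - u i)) 0 P'"
    using LIMSEQ_Suc[OF P'] by (simp add: raw_has_prod_def p_def lessThan_Suc_atMost)
  then have "(\<lambda>i. inverse (1 - u i)) has_prod P'"
    by (simp add: has_prod_def)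
  then have "P' = P"
    unfolding P_def by (rule has_prod_unique)
  ultimately show "(\<lambda>m. \<Prod>i<m. inverse (1 - u i)) \<longlonglongrightarrow> P" "P \<noteq> 0"
      "av (P - (\<Prod>i<m. inverse (1 - u i))) \<le> 1 / real CARD('q) ^ Suc m"
    using P' near'[of m] by (simp_all only: p_def[abs_def] not_False_eq_True)
qed

lemma const_hom: "const 1 = 1" "const (x + y) = const x + const y" "const (x * y) = const x * const y"
  by (simp_all add: const_def embed_1 flip: embed_add embed_mult fls_plus_const)

sublocale fq: finite_field_algebra const
  by standard (simp_all add: const_hom)

sublocale val: ring_hom_eval const
  by standard (simp_all add: const_hom)

lemma value_at_eq: "value_at \<iota> a x = val.ev a x"
  unfolding value_at_def val.ev_def by (simp only: const_def[abs_def])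

lemma const_eq_0_iff [simp]: "const c = 0 \<longleftrightarrow> c = 0"
proof (cases "c = 0")
  case False
  then have "const (inverse c) * const c = 1"
    by (simp add: const_hom(1) flip: const_hom(3))
  with False show ?thesis
    by auto
qed (simp add: fq.h_0)

lemma av_const: "c \<noteq> 0 \<Longrightarrow> av (const c) = 1"
  using dist_embed[of "fls_const c"] by (simp add: av_def const_def)

lemma av_const_le: "av (const c) \<le> 1"
  by (cases "c = 0") (auto simp: av_const fq.h_0)

lemma av_theta: "av \<theta> = real CARD('q)"
  using dist_embed[of "fls_X_inv"] by (simp add: av_def theta_def)

lemma theta_nonzero [simp]: "\<theta> \<noteq> 0"
  using av_theta CARD_gt_1 by auto

lemma av_value_theta:
  assumes "a \<noteq> 0"
  shows "av (val.ev a \<theta>) = real CARD('q) ^ degree a"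
  using assms
proof (induction a)
  case (pCons c a)
  show ?case
  proof (cases "a = 0")
    case True
    with pCons show ?thesis
      by (simp add: av_const)
  next
    case False
    have "1 < real CARD('q) ^ Suc (degree a)"
      using CARD_gt_1 by (simp add: one_less_power del: power_Suc)
    then have "av (\<theta> * val.ev a \<theta> + const c) = real CARD('q) ^ Suc (degree a)"
      using av_const_le[of c] pCons False by (subst av_add_eq) (auto simp: av_mult av_theta)
    then show ?thesis
      using False by (simp add: add.commute)
  qed
qed simp

lemma value_theta_eq_0_iff [simp]: "val.ev a \<theta> = 0 \<longleftrightarrow> a = 0"
  using av_value_theta[of a] CARD_gt_1 by force

text \<open>
  Coefficients in \<open>\<bbbF>\<^sub>q\<close> are fixed by Frobenius. For \<open>x = \<zeta>\<close> this makes powers of roots of \<open>p\<close> roots; for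
  \<open>x = \<theta>\<close> it turns powers of \<open>1/p(\<theta>)\<close> into values of \<open>1/p\<close>.
\<close>

lemma value_frob: "val.ev a (x ^ (CARD('q) ^ n)) = val.ev a x ^ (CARD('q) ^ n)"
  by (induction a) (simp_all add: fq.frob_power_add power_mult_distrib power_0_left)

end

section \<open>Carlitz's exponential as a limit of residue sums\<close>

locale carlitz_period = C_infty \<iota>
  for \<iota> :: "'q::{field,finite} fls \<Rightarrow> 'c::{field,complete_space}" +
  fixes \<rho> :: 'c
  assumes rho: "\<rho> ^ (CARD('q) - 1) = - theta \<iota>"
begin

lemma prod_inverse_fun: "(\<Prod>i\<in>I. inverse (f i)) = inverse (\<Prod>i\<in>I. f i :: 'c)"
  using prod_inversef[of f I] by (simp add: comp_def)

lemma rho_nonzero: "\<rho> \<noteq> 0"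
  using rho CARD_ge_2 theta_nonzero by (auto simp: power_0_left)

lemma rho_power_CARD: "\<rho> ^ CARD('q) = - \<theta> * \<rho>"
  using power_minus_mult[of "CARD('q)" \<rho>] rho by simp

lemma rho_frob_power: "\<rho> ^ (CARD('q) ^ n) = \<rho> * (\<Prod>i<n. - (\<theta> ^ (CARD('q) ^ i)))"
proof (induction n)
  case (Suc n)
  have "\<rho> ^ (CARD('q) ^ Suc n) = (\<rho> ^ (CARD('q) ^ n)) ^ CARD('q)"
    by (simp add: mult.commute flip: power_mult)
  also have "\<dots> = \<rho> ^ CARD('q) * (\<Prod>i<n. (- (\<theta> ^ (CARD('q) ^ i))) ^ CARD('q))"
    unfolding Suc by (simp add: power_mult_distrib prod_power_distrib)
  also have "\<dots> = \<rho> ^ CARD('q) * (\<Prod>i<n. - (\<theta> ^ (CARD('q) ^ Suc i)))"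
    using fq.frob_power_uminus[of _ 1] by (simp add: mult.commute flip: power_mult)
  also have "\<dots> = \<rho> * (\<Prod>i<Suc n. - (\<theta> ^ (CARD('q) ^ i)))"
    unfolding rho_power_CARD prod.lessThan_Suc_shift by simp
  finally show ?case .
qed simp

lemma CARD_power_gt: "n < CARD('q) ^ n"
  using CARD_ge_2 by (intro power_gt_expt) auto

lemma av_theta_power: "av (\<theta> ^ n) = real CARD('q) ^ n"
  by (simp add: av_power av_theta)

lemma theta_frob_inj: "\<theta> ^ (CARD('q) ^ i) = \<theta> ^ (CARD('q) ^ j) \<longleftrightarrow> i = j"
proof
  assume "\<theta> ^ (CARD('q) ^ i) = \<theta> ^ (CARD('q) ^ j)"
  then have "real CARD('q) ^ (CARD('q) ^ i) = real CARD('q) ^ (CARD('q) ^ j)"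
    by (metis av_theta_power)
  then have "CARD('q) ^ i = CARD('q) ^ j"
    using power_inject_exp[OF CARD_gt_1] by blast
  then show "i = j"
    using CARD_ge_2 by simp
qed simp

lemma theta_frob_neq:
  assumes "av t \<le> 1"
  shows "\<theta> ^ (CARD('q) ^ i) \<noteq> t"
proof
  assume "\<theta> ^ (CARD('q) ^ i) = t"
  then have "real CARD('q) ^ (CARD('q) ^ i) \<le> 1"
    using assms av_theta_power by metis
  moreover have "1 < real CARD('q) ^ (CARD('q) ^ i)"
    using CARD_gt_1 by (intro one_less_power) auto
  ultimately show False
    by simp
qed

lemma inverse_1_minus_divide: "x \<noteq> 0 \<Longrightarrow> inverse (1 - t / x) = x * inverse (x - t)" for x t :: 'c
proof -
  assume "x \<noteq> 0"
  then have "1 - t / x = (x - t) / x"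
    by (simp add: diff_divide_distrib)
  then show ?thesis
    by (simp add: inverse_divide divide_inverse)
qed

definition omega_partial :: "nat \<Rightarrow> 'c \<Rightarrow> 'c" where
  "omega_partial m t = \<rho> * (\<Prod>i<m. inverse (1 - t / \<theta> ^ (CARD('q) ^ i)))"

text \<open>
  Up to sign, the residue of the partial product \<open>omega_partial m\<close>, a rational function of \<open>t\<close>, at its
  \<open>n\<close>-th pole.
\<close>

definition omega_residue :: "nat \<Rightarrow> nat \<Rightarrow> 'c" where
  "omega_residue m n = \<rho> * \<theta> ^ (CARD('q) ^ n) *
     (\<Prod>i\<in>{..<m} - {n}. inverse (1 - \<theta> ^ (CARD('q) ^ n) / \<theta> ^ (CARD('q) ^ i)))"

lemma omega_factor_small:
  assumes "av t \<le> 1"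
  shows "av (t / \<theta> ^ (CARD('q) ^ i)) \<le> 1 / real CARD('q) ^ Suc i"
proof -
  have "av (t / \<theta> ^ (CARD('q) ^ i)) \<le> 1 / real CARD('q) ^ (CARD('q) ^ i)"
    using assms CARD_gt_1 by (simp add: av_divide av_theta_power divide_right_mono)
  also have "\<dots> \<le> 1 / real CARD('q) ^ Suc i"
    using CARD_power_gt[of i] CARD_gt_1 by (intro divide_left_mono power_increasing) auto
  finally show ?thesis .
qed

lemma omega_partial_tendsto:
  assumes "av t \<le> 1"
  shows "(\<lambda>m. omega_partial m t) \<longlonglongrightarrow> omega \<iota> \<rho> t"
  unfolding omega_partial_def omega_def
  by (intro valued_tendsto_mult_left prodinf_near_1 omega_factor_small assms)

lemma omega_nonzero:
  assumes "av t \<le> 1"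
  shows "omega \<iota> \<rho> t \<noteq> 0"
  unfolding omega_def
  using prodinf_near_1(2)[OF omega_factor_small[OF assms]] rho_nonzero by simp

lemma omega_partial_eq_sum:
  assumes t: "av t \<le> 1" and "m > 0"
  shows "omega_partial m t = (\<Sum>n<m. omega_residue m n * inverse (\<theta> ^ (CARD('q) ^ n) - t))"
proof -
  define x where "x i = \<theta> ^ (CARD('q) ^ i)" for i
  have x0: "x i \<noteq> 0" for i
    by (simp add: x_def)
  have neq: "t \<noteq> \<theta> ^ (CARD('q) ^ i)" for i
    using theta_frob_neq[OF t] by metis
  \<comment> \<open>The variable is \<open>- t\<close> and the nodes are \<open>- x i\<close>, so that the factors become \<open>x i - t\<close>.\<close>
  have "inverse (\<Prod>i<m. - t - - x i) =
        (\<Sum>n<m. inverse (- t - - x n) * inverse (\<Prod>j\<in>{..<m} - {n}. - x n - - x j))"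
    by (rule inverse_prod_diff_partial_fractions)
       (use \<open>m > 0\<close> neq in \<open>auto simp: inj_on_def x_def theta_frob_inj\<close>)
  then have pf: "inverse (\<Prod>i<m. x i - t) =
        (\<Sum>n<m. inverse (x n - t) * inverse (\<Prod>j\<in>{..<m} - {n}. x j - x n))"
    by simp
  have "omega_partial m t = \<rho> * (\<Prod>i<m. x i) * inverse (\<Prod>i<m. x i - t)"
    by (simp add: omega_partial_def inverse_1_minus_divide prod.distrib prod_inverse_fun x_def)
  also have "\<dots> = (\<Sum>n<m. \<rho> * (\<Prod>i<m. x i) * (inverse (x n - t) * inverse (\<Prod>j\<in>{..<m} - {n}. x j - x n)))"
    unfolding pf by (simp add: sum_distrib_left)
  also have "\<dots> = (\<Sum>n<m. omega_residue m n * inverse (x n - t))"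
  proof (rule sum.cong[OF refl])
    fix n assume "n \<in> {..<m}"
    then have "(\<Prod>i<m. x i) = x n * (\<Prod>i\<in>{..<m} - {n}. x i)"
      by (simp add: prod.remove)
    then show "\<rho> * (\<Prod>i<m. x i) * (inverse (x n - t) * inverse (\<Prod>j\<in>{..<m} - {n}. x j - x n)) =
               omega_residue m n * inverse (x n - t)"
      by (simp add: omega_residue_def inverse_1_minus_divide x0 prod.distrib prod_inverse_fun flip: x_def)
  qed
  finally show ?thesis
    by (simp add: x_def)
qed

text \<open>
  The infinite product in the definition of the period. Its \<open>n\<close>-fold Frobenius power consists of the
  factors with index above \<open>n\<close> in the limit of the \<open>n\<close>-th residue of omega; this is why the coefficients of
  \<open>exp\<close> at the period and the residues of omega agree.
\<close>

definition period_prod :: 'c where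
  "period_prod = (\<Prod>i. inverse (1 - \<theta> / \<theta> ^ (CARD('q) ^ Suc i)))"

lemma pi_tilde_eq: "pi_tilde \<iota> \<rho> = \<theta> * \<rho> * period_prod"
proof -
  have "\<theta> powi (1 - int CARD('q) ^ Suc i) = \<theta> / \<theta> ^ (CARD('q) ^ Suc i)" for i
  proof -
    have "\<theta> powi (int CARD('q) ^ Suc i) = \<theta> ^ (CARD('q) ^ Suc i)"
      by (metis of_nat_power power_int_of_nat)
    then show ?thesis
      by (subst power_int_diff) (simp_all del: power_Suc)
  qed
  then show ?thesis
    by (simp add: pi_tilde_def period_prod_def)
qed

lemma period_prod_close:
  "av (period_prod - (\<Prod>i<m. inverse (1 - \<theta> / \<theta> ^ (CARD('q) ^ Suc i)))) \<le> 1 / real CARD('q) ^ Suc m"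
  unfolding period_prod_def
proof (rule prodinf_near_1(3))
  fix i
  have "Suc (Suc i) \<le> CARD('q) ^ Suc i"
    using CARD_power_gt[of "Suc i"] by (simp del: power_Suc)
  then have "real CARD('q) ^ Suc (Suc i) \<le> real CARD('q) ^ (CARD('q) ^ Suc i)"
    using CARD_gt_1 by (intro power_increasing) auto
  then show "av (\<theta> / \<theta> ^ (CARD('q) ^ Suc i)) \<le> 1 / real CARD('q) ^ Suc i"
    using CARD_gt_1 unfolding av_divide av_theta_power av_theta
    by (subst frac_le_eq) (auto simp: field_simps divide_le_eq)
qed

lemma exp_term_eq:
  "(pi_tilde \<iota> \<rho> * y) ^ (CARD('q) ^ n) / carlitz_d \<iota> n =
     \<rho> * \<theta> ^ (CARD('q) ^ n) * (\<Prod>i<n. inverse (1 - \<theta> ^ (CARD('q) ^ n) / \<theta> ^ (CARD('q) ^ i))) *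
     period_prod ^ (CARD('q) ^ n) * y ^ (CARD('q) ^ n)"
proof -
  define A where "A = (\<Prod>i<n. - (\<theta> ^ (CARD('q) ^ i)))"
  define B where "B = (\<Prod>i<n. 1 - \<theta> ^ (CARD('q) ^ n) / \<theta> ^ (CARD('q) ^ i))"
  have "A \<noteq> 0"
    by (simp add: A_def)
  have "carlitz_d \<iota> n = A * B"
    by (simp add: carlitz_d_def A_def B_def algebra_simps flip: prod.distrib)
  then have "(pi_tilde \<iota> \<rho> * y) ^ (CARD('q) ^ n) / carlitz_d \<iota> n =
      \<theta> ^ (CARD('q) ^ n) * (\<rho> * A) * period_prod ^ (CARD('q) ^ n) * y ^ (CARD('q) ^ n) / (A * B)"
    by (simp add: pi_tilde_eq power_mult_distrib rho_frob_power A_def)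
  also have "\<dots> = \<rho> * \<theta> ^ (CARD('q) ^ n) * inverse B * period_prod ^ (CARD('q) ^ n) * y ^ (CARD('q) ^ n)"
    using \<open>A \<noteq> 0\<close> by (simp add: divide_inverse)
  finally show ?thesis
    by (simp add: B_def prod_inverse_fun)
qed

lemma omega_residue_eq:
  "omega_residue (Suc n + m) n =
     \<rho> * \<theta> ^ (CARD('q) ^ n) * (\<Prod>i<n. inverse (1 - \<theta> ^ (CARD('q) ^ n) / \<theta> ^ (CARD('q) ^ i))) *
     (\<Prod>i<m. inverse (1 - \<theta> / \<theta> ^ (CARD('q) ^ Suc i))) ^ (CARD('q) ^ n)"
proof -
  define f where "f i = inverse (1 - \<theta> ^ (CARD('q) ^ n) / \<theta> ^ (CARD('q) ^ i))" for i
  have "i \<in> {..<n} \<union> (\<lambda>i. Suc n + i) ` {..<m}" if "i < Suc n + m" "i \<noteq> n" for i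
    using that by (cases "i < n") (auto intro!: image_eqI[of _ _ "i - Suc n"])
  then have I: "{..<Suc n + m} - {n} = {..<n} \<union> (\<lambda>i. Suc n + i) ` {..<m}"
    by auto
  have "(\<Prod>i\<in>{..<Suc n + m} - {n}. f i) = (\<Prod>i<n. f i) * (\<Prod>i\<in>(\<lambda>i. Suc n + i) ` {..<m}. f i)"
    unfolding I by (rule prod.union_disjoint) auto
  also have "(\<Prod>i\<in>(\<lambda>i. Suc n + i) ` {..<m}. f i) = (\<Prod>i<m. f (Suc n + i))"
    by (subst prod.reindex) (auto simp: inj_on_def)
  also have "\<dots> = (\<Prod>i<m. inverse (1 - \<theta> / \<theta> ^ (CARD('q) ^ Suc i)) ^ (CARD('q) ^ n))"
  proof (rule prod.cong[OF refl])
    fix i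
    have "inverse (1 - \<theta> / \<theta> ^ (CARD('q) ^ Suc i)) ^ (CARD('q) ^ n) =
          inverse (1 - \<theta> ^ (CARD('q) ^ n) / \<theta> ^ (CARD('q) ^ Suc i * CARD('q) ^ n))"
      by (simp add: power_inverse fq.frob_power_diff power_divide power_mult)
    also have "CARD('q) ^ Suc i * CARD('q) ^ n = CARD('q) ^ (Suc n + i)"
      by (simp add: power_add)
    finally show "f (Suc n + i) = inverse (1 - \<theta> / \<theta> ^ (CARD('q) ^ Suc i)) ^ (CARD('q) ^ n)"
      by (simp add: f_def)
  qed
  finally show ?thesis
    by (simp add: omega_residue_def f_def prod_power_distrib mult.assoc del: power_Suc)
qed

text \<open>
  The two sides differ only in a Frobenius power of the tail of \<open>period_prod\<close>. The factors with
  index below \<open>n\<close> contribute a bound geometric in \<open>n\<close>, the tail one geometric in \<open>m - n\<close>; hence the product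
  is uniform in \<open>n\<close> and may be summed over \<open>n < m\<close>.
\<close>

lemma exp_term_close:
  assumes y: "av y \<le> 1 / real CARD('q)" and "n < m"
  shows "av ((pi_tilde \<iota> \<rho> * y) ^ (CARD('q) ^ n) / carlitz_d \<iota> n
             - omega_residue m n * y ^ (CARD('q) ^ n)) \<le> av \<rho> / real CARD('q) ^ m"
proof -
  obtain M where m: "m = Suc n + M"
    using \<open>n < m\<close> less_imp_Suc_add by fastforce
  define R where "R = (\<Prod>i<n. inverse (1 - \<theta> ^ (CARD('q) ^ n) / \<theta> ^ (CARD('q) ^ i)))"
  define P where "P = (\<Prod>i<M. inverse (1 - \<theta> / \<theta> ^ (CARD('q) ^ Suc i)))"
  define e where "e = 1 / real CARD('q)"
  have e: "0 < e" "e < 1"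
    using CARD_gt_1 by (auto simp: e_def)
  have "(pi_tilde \<iota> \<rho> * y) ^ (CARD('q) ^ n) / carlitz_d \<iota> n - omega_residue m n * y ^ (CARD('q) ^ n) =
      \<rho> * (\<theta> * y) ^ (CARD('q) ^ n) * R * (period_prod - P) ^ (CARD('q) ^ n)"
    unfolding exp_term_eq m omega_residue_eq R_def[symmetric] P_def[symmetric]
    unfolding fq.frob_power_diff power_mult_distrib
    by (simp only: algebra_simps)
  moreover have "av ((\<theta> * y) ^ (CARD('q) ^ n)) \<le> 1"
    using y CARD_gt_1 unfolding av_power av_mult av_theta
    by (intro power_le_one) (auto simp: field_simps)
  moreover have "av R \<le> e ^ n"
  proof -
    have "av R = (\<Prod>i<n. inverse (av (1 - \<theta> ^ (CARD('q) ^ n) / \<theta> ^ (CARD('q) ^ i))))"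
      by (simp add: R_def av_prod av_inverse)
    also have "\<dots> \<le> (\<Prod>i<n. e)"
    proof (intro prod_mono conjI)
      fix i assume "i \<in> {..<n}"
      then have "CARD('q) ^ i < CARD('q) ^ n"
        using CARD_ge_2 by (intro power_strict_increasing) auto
      then have "real CARD('q) ^ Suc (CARD('q) ^ i) \<le> real CARD('q) ^ (CARD('q) ^ n)"
        by (rule power_increasing[OF Suc_leI]) (use CARD_gt_1 in simp)
      then have ge: "av (\<theta> ^ (CARD('q) ^ n) / \<theta> ^ (CARD('q) ^ i)) \<ge> real CARD('q)"
        using CARD_gt_1 by (simp add: av_divide av_theta_power field_simps)
      then have "av (- (\<theta> ^ (CARD('q) ^ n) / \<theta> ^ (CARD('q) ^ i)) + 1) = av (- (\<theta> ^ (CARD('q) ^ n) / \<theta> ^ (CARD('q) ^ i)))"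
        using CARD_gt_1 by (intro av_add_eq) simp
      with ge have "av (1 - \<theta> ^ (CARD('q) ^ n) / \<theta> ^ (CARD('q) ^ i)) \<ge> real CARD('q)"
        by simp
      then show "inverse (av (1 - \<theta> ^ (CARD('q) ^ n) / \<theta> ^ (CARD('q) ^ i))) \<le> e"
        unfolding e_def inverse_eq_divide[symmetric] by (rule le_imp_inverse_le) (use CARD_gt_1 in simp)
    qed simp
    finally show ?thesis
      by simp
  qed
  moreover have "av ((period_prod - P) ^ (CARD('q) ^ n)) \<le> e ^ Suc M"
  proof -
    have le: "av (period_prod - P) \<le> e ^ Suc M"
      using period_prod_close[of M] by (simp add: P_def e_def power_divide)
    moreover have "e ^ Suc M \<le> 1"
      using e by (intro power_le_one) auto
    ultimately have "av (period_prod - P) ^ (CARD('q) ^ n) \<le> av (period_prod - P) ^ 1"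
      using CARD_ge_2 by (intro power_decreasing) auto
    with le show ?thesis
      by (simp add: av_power)
  qed
  ultimately have "av ((pi_tilde \<iota> \<rho> * y) ^ (CARD('q) ^ n) / carlitz_d \<iota> n - omega_residue m n * y ^ (CARD('q) ^ n))
      \<le> av \<rho> * 1 * e ^ n * e ^ Suc M"
    using e by (simp only: av_mult) (intro mult_mono, auto)
  also have "\<dots> = av \<rho> / real CARD('q) ^ m"
    by (simp add: m e_def power_divide power_add)
  finally show ?thesis .
qed

lemma carlitz_exp_eq_limit:
  assumes y: "av y \<le> 1 / real CARD('q)"
    and lim: "(\<lambda>m. \<Sum>n<m. omega_residue m n * y ^ (CARD('q) ^ n)) \<longlonglongrightarrow> L"
  shows "carlitz_exp \<iota> (pi_tilde \<iota> \<rho> * y) = L"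
proof -
  define t where "t n = (pi_tilde \<iota> \<rho> * y) ^ (CARD('q) ^ n) / carlitz_d \<iota> n" for n
  define D where "D m = (\<Sum>n<m. t n - omega_residue m n * y ^ (CARD('q) ^ n))" for m
  have D_le: "av (D m) \<le> av \<rho> * (1 / real CARD('q)) ^ m" for m
  proof -
    have "av (D m) \<le> av \<rho> / real CARD('q) ^ m"
      unfolding D_def t_def by (intro av_sum_le exp_term_close y) auto
    then show ?thesis
      by (simp add: power_divide)
  qed
  have lim0: "(\<lambda>m. av \<rho> * (1 / real CARD('q)) ^ m) \<longlonglongrightarrow> 0"
    using CARD_gt_1 by (intro tendsto_mult_right_zero LIMSEQ_realpow_zero) auto
  have "(\<lambda>m. av (D m)) \<longlonglongrightarrow> 0"
    by (intro tendsto_sandwich[OF _ _ tendsto_const lim0] always_eventually) (simp_all add: D_le)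
  then have "D \<longlonglongrightarrow> 0"
    by (simp add: tendsto_iff_av[of D])
  from valued_tendsto_add[OF this lim] have "t sums L"
    by (simp add: sums_def D_def sum_subtractf)
  then show ?thesis
    unfolding carlitz_exp_def t_def[symmetric] by (rule sums_unique[symmetric])
qed

end

section \<open>The residue field at the prime and its units\<close>

lemma card_polys_vanishing_above:
  "finite {a :: 'q::{field,finite} poly. \<forall>i\<ge>n. coeff a i = 0} \<and>
   card {a :: 'q poly. \<forall>i\<ge>n. coeff a i = 0} = CARD('q) ^ n"
proof (induction n)
  case 0
  have "{a :: 'q poly. \<forall>i\<ge>0. coeff a i = 0} = {0}"
    by (auto simp: poly_eq_iff)
  then show ?case
    by simp
next
  case (Suc n)
  define S where "S = {a :: 'q poly. \<forall>i\<ge>n. coeff a i = 0}"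
  have "{a :: 'q poly. \<forall>i\<ge>Suc n. coeff a i = 0} = (\<lambda>(c, a). pCons c a) ` (UNIV \<times> S)"
  proof (intro equalityI subsetI)
    fix a :: "'q poly" assume a: "a \<in> {a. \<forall>i\<ge>Suc n. coeff a i = 0}"
    obtain c b where ab: "a = pCons c b"
      by (cases a)
    have "coeff b i = 0" if "i \<ge> n" for i
      using a that by (auto simp: ab dest!: spec[of _ "Suc i"])
    then show "a \<in> (\<lambda>(c, a). pCons c a) ` (UNIV \<times> S)"
      by (auto simp: ab S_def)
  qed (auto simp: S_def coeff_pCons split: nat.splits)
  moreover have "inj_on (\<lambda>(c, a). pCons c a) (UNIV \<times> S)"
    by (auto intro!: inj_onI)
  ultimately show ?case
    using Suc by (simp add: card_image card_cartesian_product flip: S_def)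
qed

locale carlitz_prime = carlitz_period \<iota> \<rho>
  for \<iota> :: "'q::{field,finite} fls \<Rightarrow> 'c::{field,complete_space}" and \<rho> +
  fixes p :: "'q poly" and \<zeta> :: 'c
  assumes monic: "lead_coeff p = 1" and irred: "Factorial_Ring.irreducible p" and root: "val.ev p \<zeta> = 0"
begin

abbreviation d :: nat where "d \<equiv> degree p"

lemma p_nonzero: "p \<noteq> 0"
  using monic by auto

text \<open>
  \<open>p\<close> is the minimal polynomial of \<open>\<zeta>\<close>: a nonzero polynomial of least degree that vanishes at \<open>\<zeta>\<close>
  divides all others, hence divides the irreducible \<open>p\<close> and is associated to it.
\<close>

lemma value_root_eq_0_iff: "val.ev a \<zeta> = 0 \<longleftrightarrow> p dvd a"
proof
  assume a: "val.ev a \<zeta> = 0"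
  obtain m where m: "m \<noteq> 0" "val.ev m \<zeta> = 0"
    and least: "\<And>b. b \<noteq> 0 \<Longrightarrow> val.ev b \<zeta> = 0 \<Longrightarrow> degree m \<le> degree b"
    using ex_has_least_nat[of "\<lambda>b. b \<noteq> 0 \<and> val.ev b \<zeta> = 0" p degree] p_nonzero root by blast
  have m_dvd: "m dvd b" if "val.ev b \<zeta> = 0" for b
  proof (rule ccontr)
    assume "\<not> m dvd b"
    then have "b mod m \<noteq> 0"
      by (simp add: dvd_eq_mod_eq_0)
    moreover have "b mod m = b - m * (b div m)"
      by (simp add: minus_mult_div_eq_mod)
    then have "val.ev (b mod m) \<zeta> = 0"
      using m that by (simp add: val.ev_diff val.ev_mult)
    ultimately have "degree m \<le> degree (b mod m)"
      using least by blast
    moreover have "degree (b mod m) < degree m"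
      using \<open>b mod m \<noteq> 0\<close> m degree_mod_less by blast
    ultimately show False
      by simp
  qed
  obtain k where k: "p = m * k"
    using m_dvd[OF root] by blast
  have "\<not> is_unit m"
  proof
    assume "is_unit m"
    then obtain u where "1 = m * u"
      by (elim dvdE)
    then have "val.ev 1 \<zeta> = val.ev m \<zeta> * val.ev u \<zeta>"
      by (metis val.ev_mult)
    with m show False
      by simp
  qed
  then have "is_unit k"
    using irred k Factorial_Ring.irreducibleD by blast
  then have "p dvd m"
    by (simp add: k)
  with m_dvd[OF a] show "p dvd a"
    by (rule dvd_trans[rotated])
qed (auto simp: val.ev_mult root)

lemma degree_pos: "d > 0"
proof (rule ccontr)
  assume "\<not> d > 0"
  then obtain c where "p = [:c:]"
    by (auto elim: degree_eq_zeroE)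
  with monic have "p = 1"
    by (simp add: one_pCons)
  with irred show False
    by simp
qed

definition residue_field :: "'c set" where
  "residue_field = range (\<lambda>a. val.ev a \<zeta>)"

lemma residue_field_eq_image:
  "residue_field = (\<lambda>a. val.ev a \<zeta>) ` {a. \<forall>i\<ge>d. coeff a i = 0}"
proof -
  have "val.ev a \<zeta> \<in> (\<lambda>a. val.ev a \<zeta>) ` {a. \<forall>i\<ge>d. coeff a i = 0}" for a
  proof (rule image_eqI)
    have "a mod p = a - p * (a div p)"
      by (simp add: minus_mult_div_eq_mod)
    then show "val.ev a \<zeta> = val.ev (a mod p) \<zeta>"
      by (simp add: val.ev_diff val.ev_mult root)
    show "a mod p \<in> {a. \<forall>i\<ge>d. coeff a i = 0}"
      using degree_mod_less[of p a] p_nonzero by (auto intro: coeff_eq_0)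
  qed
  then show ?thesis
    by (auto simp: residue_field_def)
qed

lemma inj_on_value_root: "inj_on (\<lambda>a. val.ev a \<zeta>) {a. \<forall>i\<ge>d. coeff a i = 0}"
proof (rule inj_onI)
  fix a b assume ab: "a \<in> {a. \<forall>i\<ge>d. coeff a i = 0}" "b \<in> {a. \<forall>i\<ge>d. coeff a i = 0}"
    and "val.ev a \<zeta> = val.ev b \<zeta>"
  then have "p dvd a - b"
    by (simp add: val.ev_diff flip: value_root_eq_0_iff)
  moreover have "degree (a - b) < d" if "a - b \<noteq> 0"
    using ab that by (intro degree_lessI) auto
  ultimately show "a = b"
    using dvd_imp_degree_le[of p "a - b"] by fastforce
qed

lemma finite_residue_field: "finite residue_field"
  and card_residue_field: "card residue_field = CARD('q) ^ d"
  using card_polys_vanishing_above[of d, where ?'q = 'q] inj_on_value_root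
  by (simp_all add: residue_field_eq_image card_image)

lemma residue_field_closed:
  "0 \<in> residue_field" "1 \<in> residue_field" "\<zeta> \<in> residue_field"
  "x \<in> residue_field \<Longrightarrow> y \<in> residue_field \<Longrightarrow> x + y \<in> residue_field"
  "x \<in> residue_field \<Longrightarrow> y \<in> residue_field \<Longrightarrow> x - y \<in> residue_field"
  "x \<in> residue_field \<Longrightarrow> y \<in> residue_field \<Longrightarrow> x * y \<in> residue_field"
  "x \<in> residue_field \<Longrightarrow> x ^ n \<in> residue_field"
  "val.ev a \<zeta> \<in> residue_field"
proof -
  have "val.ev 0 \<zeta> = 0" "val.ev 1 \<zeta> = 1" "val.ev [:0, 1:] \<zeta> = \<zeta>"
    by (simp_all add: const_hom fq.h_0)
  then show "0 \<in> residue_field" "1 \<in> residue_field" "\<zeta> \<in> residue_field"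
    unfolding residue_field_def by (metis rangeI)+
qed (auto simp: residue_field_def simp flip: val.ev_add val.ev_diff val.ev_mult val.ev_power)

abbreviation units :: "'c set" where "units \<equiv> residue_field - {0}"

lemma card_units: "card units = CARD('q) ^ d - 1"
  using finite_residue_field residue_field_closed(1) by (simp add: card_residue_field)

lemma CARD_power_d: "CARD('q) ^ d \<ge> 2"
  using CARD_ge_2 degree_pos self_le_power[of "CARD('q)" d] by linarith

lemma units_power: "x \<in> units \<Longrightarrow> x ^ (CARD('q) ^ d - 1) = 1"
  unfolding card_units[symmetric]
  by (rule power_card_eq_1) (auto intro: finite_residue_field residue_field_closed)

lemma residue_field_frob:
  assumes "x \<in> residue_field"
  shows "x ^ (CARD('q) ^ d) = x"
proof (cases "x = 0")
  case False
  with assms have "x ^ (CARD('q) ^ d - 1) * x = x"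
    using units_power[of x] by simp
  then show ?thesis
    using power_minus_mult[of "CARD('q) ^ d" x] CARD_power_d by (simp only:)
qed (use CARD_ge_2 in \<open>simp add: power_0_left\<close>)

lemma inverse_unit:
  assumes "x \<in> units"
  shows "inverse x \<in> units"
proof -
  have "CARD('q) ^ d - 1 = Suc (CARD('q) ^ d - 2)"
    using CARD_power_d by linarith
  then have "x ^ (CARD('q) ^ d - 2) * x = 1"
    using units_power[OF assms] by (simp only: power_Suc2)
  then have "inverse x = x ^ (CARD('q) ^ d - 2)"
    by (metis inverse_unique mult.commute)
  then show ?thesis
    using assms residue_field_closed(7) by auto
qed

text \<open>
  If two of these conjugates agreed, a lower power of Frobenius would fix \<open>\<zeta>\<close> and hence the whole residue field,
  which has more elements than the corresponding equation has roots.
\<close>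

lemma root_conjugates_inj: "inj_on (\<lambda>k. \<zeta> ^ (CARD('q) ^ k)) {..<d}"
proof (rule linorder_inj_onI)
  fix k l assume kl: "k < l" "k \<in> {..<d}" "l \<in> {..<d}"
  define s where "s = l - k"
  have s: "0 < s" "s < d" "l = s + k"
    using kl by (auto simp: s_def)
  show "\<zeta> ^ (CARD('q) ^ k) \<noteq> \<zeta> ^ (CARD('q) ^ l)"
  proof
    assume "\<zeta> ^ (CARD('q) ^ k) = \<zeta> ^ (CARD('q) ^ l)"
    then have "\<zeta> ^ (CARD('q) ^ k) = (\<zeta> ^ (CARD('q) ^ s)) ^ (CARD('q) ^ k)"
      by (simp add: s power_add power_mult)
    then have "\<zeta> = \<zeta> ^ (CARD('q) ^ s)"
      by (simp add: fq.frob_power_inj)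
    then have fixed: "x ^ (CARD('q) ^ s) = x" if "x \<in> residue_field" for x
      using that value_frob[of _ \<zeta> s] by (auto simp: residue_field_def)
    define f :: "'c poly" where "f = monom 1 (CARD('q) ^ s) - monom 1 1"
    have qs: "1 < CARD('q) ^ s"
      using CARD_ge_2 s by (intro one_less_power) auto
    have deg: "degree f \<le> CARD('q) ^ s"
      unfolding f_def by (intro degree_diff_le) (use qs in \<open>auto simp: degree_monom_eq\<close>)
    have "coeff f (CARD('q) ^ s) = 1"
      using qs by (simp add: f_def)
    then have "f \<noteq> 0"
      by auto
    have "residue_field \<subseteq> {x. poly f x = 0}"
      using fixed by (auto simp: f_def poly_monom)
    then have "CARD('q) ^ d \<le> card {x. poly f x = 0}"
      unfolding card_residue_field[symmetric] by (rule card_mono[OF poly_roots_finite[OF \<open>f \<noteq> 0\<close>]])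
    also have "\<dots> \<le> CARD('q) ^ s"
      using card_poly_roots_bound[OF \<open>f \<noteq> 0\<close>] deg by linarith
    finally show False
      using s CARD_ge_2 by simp
  qed
qed auto

lemma map_prime_eq_prod: "map_poly const p = (\<Prod>k<d. [:- (\<zeta> ^ (CARD('q) ^ k)), 1:])"
proof (rule ccontr)
  define f where "f = map_poly const p - (\<Prod>k<d. [:- (\<zeta> ^ (CARD('q) ^ k)), 1:])"
  assume "map_poly const p \<noteq> (\<Prod>k<d. [:- (\<zeta> ^ (CARD('q) ^ k)), 1:])"
  then have "f \<noteq> 0"
    by (simp add: f_def)
  have deg1: "degree (map_poly const p) = d"
    by (rule degree_map_poly) simp
  have deg2: "degree (\<Prod>k<d. [:- (\<zeta> ^ (CARD('q) ^ k)), 1:]) = d"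
    by (subst degree_prod_eq_sum_degree) auto
  have lead: "lead_coeff (\<Prod>k<d. [:- (\<zeta> ^ (CARD('q) ^ k)), 1:]) = 1"
    by (simp add: lead_coeff_prod)
  have "coeff f d = 0"
    using lead monic by (simp add: f_def deg2 coeff_map_poly fq.h_0 const_hom)
  moreover have "coeff f i = 0" if "i > d" for i
    using that deg1 deg2 by (simp add: f_def coeff_eq_0)
  ultimately have "degree f < d"
    using \<open>f \<noteq> 0\<close> by (intro degree_lessI) (auto simp: le_less)
  have "poly f (\<zeta> ^ (CARD('q) ^ k)) = 0" if "k < d" for k
    using that value_frob[of p \<zeta> k] by (auto simp: f_def poly_prod val.ev_def root[unfolded val.ev_def] power_0_left)
  then have "(\<lambda>k. \<zeta> ^ (CARD('q) ^ k)) ` {..<d} \<subseteq> {x. poly f x = 0}"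
    by auto
  then have "card ((\<lambda>k. \<zeta> ^ (CARD('q) ^ k)) ` {..<d}) \<le> card {x. poly f x = 0}"
    by (rule card_mono[OF poly_roots_finite[OF \<open>f \<noteq> 0\<close>]])
  then have "d \<le> card {x. poly f x = 0}"
    by (simp add: card_image root_conjugates_inj)
  then show False
    using card_poly_roots_bound[OF \<open>f \<noteq> 0\<close>] \<open>degree f < d\<close> by linarith
qed

lemma value_prime: "val.ev p x = (\<Prod>k<d. x - \<zeta> ^ (CARD('q) ^ k))"
  by (simp add: val.ev_def map_prime_eq_prod poly_prod)

abbreviation \<delta>\<^sub>p :: 'c where "\<delta>\<^sub>p \<equiv> val.ev (pderiv p) \<zeta>"

text \<open>
  These values of the derivative are the denominators in the partial fraction expansion of \<open>1/p\<close>.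
\<close>

lemma value_pderiv_conj:
  assumes "k < d"
  shows "\<delta>\<^sub>p ^ (CARD('q) ^ k) = (\<Prod>l\<in>{..<d} - {k}. \<zeta> ^ (CARD('q) ^ k) - \<zeta> ^ (CARD('q) ^ l))"
proof -
  have "map_poly const (pderiv p) = pderiv (map_poly const p)"
    by (rule poly_eqI) (simp add: coeff_map_poly coeff_pderiv fq.h_0 const_hom fq.h_of_nat flip: of_nat_Suc)
  then have "\<delta>\<^sub>p ^ (CARD('q) ^ k) = poly (pderiv (\<Prod>k<d. [:- (\<zeta> ^ (CARD('q) ^ k)), 1:])) (\<zeta> ^ (CARD('q) ^ k))"
    unfolding value_frob[symmetric] by (simp add: val.ev_def map_prime_eq_prod)
  also have "\<dots> = (\<Sum>a<d. \<Prod>l\<in>{..<d} - {a}. \<zeta> ^ (CARD('q) ^ k) - \<zeta> ^ (CARD('q) ^ l))"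
    by (simp add: pderiv_prod poly_sum poly_prod pderiv_pCons)
  also have "\<dots> = (\<Sum>a\<in>{k}. \<Prod>l\<in>{..<d} - {a}. \<zeta> ^ (CARD('q) ^ k) - \<zeta> ^ (CARD('q) ^ l))"
    using assms by (intro sum.mono_neutral_right) auto
  finally show ?thesis
    by simp
qed

lemma value_pderiv_nonzero: "\<delta>\<^sub>p \<noteq> 0"
proof -
  have "\<delta>\<^sub>p ^ (CARD('q) ^ 0) \<noteq> 0"
    unfolding value_pderiv_conj[OF degree_pos]
    using root_conjugates_inj degree_pos by (force simp: inj_on_def)
  then show ?thesis
    by simp
qed

lemma av_root_power: "av (\<zeta> ^ n) \<le> 1"
proof -
  have "av \<zeta> \<le> 1"
  proof (rule ccontr)
    assume "\<not> av \<zeta> \<le> 1"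
    then have "av \<zeta> ^ 1 < av \<zeta> ^ (CARD('q) ^ d)"
      using CARD_power_d by (intro power_strict_increasing) auto
    then show False
      using residue_field_frob[OF residue_field_closed(3)] by (simp flip: av_power)
  qed
  then show ?thesis
    by (simp add: av_power power_le_one)
qed

section \<open>An explicit formula for the torsion points\<close>

text \<open>
  The function \<open>M\<close> of the introduction. For \<open>x = a(\<zeta>)\<close> its value is \<open>\<phi>\<^sub>a(\<lambda>\<^sub>p)\<close>.
\<close>

definition torsion :: "'c \<Rightarrow> 'c" where
  "torsion x = (\<Sum>k<d. x ^ (CARD('q) ^ k) * (inverse (\<delta>\<^sub>p ^ (CARD('q) ^ k)) * omega \<iota> \<rho> (\<zeta> ^ (CARD('q) ^ k))))"

text \<open>
  The sum over \<open>n\<close> of the residues of omega times the values of \<open>1/p\<close> at the poles is computed in two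
  ways: it tends to \<open>exp(\<pi>/p)\<close>, and by the partial fraction expansion of \<open>1/p\<close> it is a combination of
  partial products of omega at the roots of \<open>p\<close>.
\<close>

lemma lambda_eq_torsion: "lambda_p \<iota> \<rho> p = torsion 1"
proof -
  define y where "y = inverse (val.ev p \<theta>)"
  have y: "av y \<le> 1 / real CARD('q)"
  proof -
    have "real CARD('q) \<le> av (val.ev p \<theta>)"
      using CARD_gt_1 degree_pos p_nonzero self_le_power[of "real CARD('q)" d] by (simp add: av_value_theta)
    then show ?thesis
      unfolding y_def av_inverse inverse_eq_divide[symmetric]
      by (rule le_imp_inverse_le) (use CARD_gt_1 in simp)
  qed
  have y_frob: "y ^ (CARD('q) ^ n) =
      (\<Sum>k<d. inverse (\<theta> ^ (CARD('q) ^ n) - \<zeta> ^ (CARD('q) ^ k)) * inverse (\<delta>\<^sub>p ^ (CARD('q) ^ k)))" for n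
  proof -
    have neq: "\<theta> ^ (CARD('q) ^ n) \<noteq> \<zeta> ^ (CARD('q) ^ k)" for k
      by (rule theta_frob_neq[OF av_root_power])
    have "y ^ (CARD('q) ^ n) = inverse (val.ev p (\<theta> ^ (CARD('q) ^ n)))"
      by (simp add: y_def power_inverse value_frob)
    also have "\<dots> = inverse (\<Prod>k<d. \<theta> ^ (CARD('q) ^ n) - \<zeta> ^ (CARD('q) ^ k))"
      by (simp add: value_prime)
    also have "\<dots> = (\<Sum>k<d. inverse (\<theta> ^ (CARD('q) ^ n) - \<zeta> ^ (CARD('q) ^ k)) *
        inverse (\<Prod>l\<in>{..<d} - {k}. \<zeta> ^ (CARD('q) ^ k) - \<zeta> ^ (CARD('q) ^ l)))"
      using degree_pos neq by (intro inverse_prod_diff_partial_fractions root_conjugates_inj) auto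
    finally show ?thesis
      by (simp add: value_pderiv_conj)
  qed
  have "(\<Sum>n<m. omega_residue m n * y ^ (CARD('q) ^ n)) =
        (\<Sum>k<d. inverse (\<delta>\<^sub>p ^ (CARD('q) ^ k)) * omega_partial m (\<zeta> ^ (CARD('q) ^ k)))" if "m > 0" for m
  proof -
    have "(\<Sum>n<m. omega_residue m n * y ^ (CARD('q) ^ n)) = (\<Sum>n<m. \<Sum>k<d. inverse (\<delta>\<^sub>p ^ (CARD('q) ^ k)) *
        (omega_residue m n * inverse (\<theta> ^ (CARD('q) ^ n) - \<zeta> ^ (CARD('q) ^ k))))"
      by (simp add: y_frob sum_distrib_left mult_ac)
    also have "\<dots> = (\<Sum>k<d. \<Sum>n<m. inverse (\<delta>\<^sub>p ^ (CARD('q) ^ k)) *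
        (omega_residue m n * inverse (\<theta> ^ (CARD('q) ^ n) - \<zeta> ^ (CARD('q) ^ k))))"
      by (rule sum.swap)
    finally show ?thesis
      using that by (simp add: omega_partial_eq_sum[OF av_root_power] sum_distrib_left)
  qed
  moreover have "(\<lambda>m. \<Sum>k<d. inverse (\<delta>\<^sub>p ^ (CARD('q) ^ k)) * omega_partial m (\<zeta> ^ (CARD('q) ^ k))) \<longlonglongrightarrow> torsion 1"
    unfolding torsion_def power_one mult_1_left
    by (intro valued_tendsto_sum valued_tendsto_mult_left omega_partial_tendsto av_root_power)
  ultimately have "(\<lambda>m. \<Sum>n<m. omega_residue m n * y ^ (CARD('q) ^ n)) \<longlonglongrightarrow> torsion 1"
    by (subst tendsto_cong[OF eventually_mono[OF eventually_gt_at_top[of 0]]]) auto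
  from carlitz_exp_eq_limit[OF y this] show ?thesis
    by (simp add: lambda_p_def value_at_eq y_def divide_inverse)
qed

lemma torsion_add: "torsion (x + y) = torsion x + torsion y"
  by (simp add: torsion_def fq.frob_power_add distrib_right sum.distrib)

lemma torsion_const_mult: "torsion (const c * x) = const c * torsion x"
  by (simp add: torsion_def power_mult_distrib sum_distrib_left mult.assoc)

lemma torsion_0 [simp]: "torsion 0 = 0"
  by (simp add: torsion_def power_0_left)

lemma torsion_diff: "torsion (x - y) = torsion x - torsion y"
  using torsion_add[of "x - y" y] by simp

lemma torsion_sum: "torsion (\<Sum>i\<in>I. f i) = (\<Sum>i\<in>I. torsion (f i))"
  by (induction I rule: infinite_finite_induct) (auto simp: torsion_add)

text \<open>
  Frobenius moves each factor of omega to the next one; the missing factor with index 0 and the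
  relation between \<open>\<rho>\<^sup>q\<close> and \<open>\<rho>\<close> account for \<open>t\<^sup>q - \<theta>\<close>.
\<close>

lemma omega_frob:
  assumes t: "av t \<le> 1"
  shows "omega \<iota> \<rho> t ^ CARD('q) = (t ^ CARD('q) - \<theta>) * omega \<iota> \<rho> (t ^ CARD('q))"
proof -
  have tq: "av (t ^ CARD('q)) \<le> 1"
    using t by (simp add: av_power power_le_one)
  have "omega_partial m t ^ CARD('q) = (t ^ CARD('q) - \<theta>) * omega_partial (Suc m) (t ^ CARD('q))" for m
  proof -
    have "\<theta> \<noteq> t ^ CARD('q)"
      using theta_frob_neq[OF tq, of 0] by simp
    then have 0: "(t ^ CARD('q) - \<theta>) * inverse (1 - t ^ CARD('q) / \<theta>) = - \<theta>"
      by (simp add: inverse_1_minus_divide field_simps)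
    have "(1 - t / \<theta> ^ (CARD('q) ^ i)) ^ CARD('q) = 1 - t ^ CARD('q) / \<theta> ^ (CARD('q) ^ Suc i)" for i
      using fq.frob_power_diff[of 1 "t / \<theta> ^ (CARD('q) ^ i)" 1]
      by (simp add: power_divide mult.commute flip: power_mult)
    then have "omega_partial m t ^ CARD('q) =
        - \<theta> * (\<rho> * (\<Prod>i<m. inverse (1 - t ^ CARD('q) / \<theta> ^ (CARD('q) ^ Suc i))))"
      by (simp add: omega_partial_def power_mult_distrib rho_power_CARD power_inverse prod_power_distrib)
    also have "\<dots> = (t ^ CARD('q) - \<theta>) * omega_partial (Suc m) (t ^ CARD('q))"
      unfolding omega_partial_def prod.lessThan_Suc_shift 0[symmetric] by (simp add: mult_ac)
    finally show ?thesis .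
  qed
  then have "(\<lambda>m. omega_partial m t ^ CARD('q)) \<longlonglongrightarrow> (t ^ CARD('q) - \<theta>) * omega \<iota> \<rho> (t ^ CARD('q))"
    using LIMSEQ_Suc[OF omega_partial_tendsto[OF tq]] by (simp add: valued_tendsto_mult_left)
  moreover have "(\<lambda>m. omega_partial m t ^ CARD('q)) \<longlonglongrightarrow> omega \<iota> \<rho> t ^ CARD('q)"
  proof -
    have "(\<lambda>m. av (omega_partial m t - omega \<iota> \<rho> t) ^ CARD('q)) \<longlonglongrightarrow> 0 ^ CARD('q)"
      using omega_partial_tendsto[OF t] unfolding tendsto_iff_av[of _ "omega \<iota> \<rho> t"] by (rule tendsto_power)
    then show ?thesis
      unfolding tendsto_iff_av[of _ "omega \<iota> \<rho> t ^ CARD('q)"]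
      using fq.frob_power_diff[of _ "omega \<iota> \<rho> t" 1] by (simp add: power_0_left flip: av_power)
  qed
  ultimately show ?thesis
    by (rule LIMSEQ_unique[rotated])
qed

text \<open>
  By the functional equation of omega, the \<open>q\<close>-th power of \<open>M(x)\<close> is the sum of the terms of
  \<open>M(\<zeta> x) - \<theta> M(x)\<close> with indices shifted by one. The shift is cyclic because the \<open>d\<close>-th power of Frobenius
  fixes \<open>x\<close>, \<open>\<zeta>\<close> and the derivative, which all lie in the residue field.
\<close>

lemma carlitz_theta_torsion:
  assumes "x \<in> residue_field"
  shows "\<theta> * torsion x + torsion x ^ CARD('q) = torsion (\<zeta> * x)"
proof -
  define g where "g k = x ^ (CARD('q) ^ k) * (inverse (\<delta>\<^sub>p ^ (CARD('q) ^ k)) *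
      ((\<zeta> ^ (CARD('q) ^ k) - \<theta>) * omega \<iota> \<rho> (\<zeta> ^ (CARD('q) ^ k))))" for k
  have frob: "(y ^ (CARD('q) ^ k)) ^ CARD('q) = y ^ (CARD('q) ^ Suc k)" for y :: 'c and k
    by (simp add: mult.commute flip: power_mult)
  have frob_sum: "(\<Sum>k<d. f k) ^ CARD('q) = (\<Sum>k<d. f k ^ CARD('q))" for f :: "nat \<Rightarrow> 'c"
    using fq.frob_power_sum[of f "{..<d}" 1] by simp
  have "torsion x ^ CARD('q) = (\<Sum>k<d. g (Suc k))"
    unfolding torsion_def frob_sum
    by (simp add: power_mult_distrib frob omega_frob[OF av_root_power] g_def power_inverse del: power_Suc)
  also have "\<dots> = (\<Sum>k<d. g k)"
  proof -
    have "g d = g 0"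
      using assms by (simp add: g_def residue_field_frob residue_field_closed)
    then show ?thesis
      using sum.lessThan_Suc_shift[of g d] by simp
  qed
  also have "\<dots> = torsion (\<zeta> * x) - \<theta> * torsion x"
    by (simp add: torsion_def g_def sum_distrib_left power_mult_distrib algebra_simps flip: sum_subtractf)
  finally show ?thesis
    by simp
qed

lemma carlitz_module_torsion:
  assumes "x \<in> residue_field"
  shows "carlitz_module \<iota> a (torsion x) = torsion (val.ev a \<zeta> * x)"
proof -
  have "((\<lambda>x. \<theta> * x + x ^ CARD('q)) ^^ i) (torsion x) = torsion (\<zeta> ^ i * x)" for i
    by (induction i) (simp_all add: carlitz_theta_torsion residue_field_closed assms mult.assoc)
  then show ?thesis
    by (simp add: carlitz_module_def val.ev_altdef sum_distrib_right torsion_sum torsion_const_mult mult.assoc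
             flip: const_def)
qed

text \<open>
  For \<open>j = k\<close> the sum counts the \<open>q\<^sup>d - 1\<close> units. Otherwise the substitution \<open>x \<mapsto> \<zeta> x\<close> multiplies the sum by
  a quotient of two distinct conjugates of \<open>\<zeta>\<close>.
\<close>

lemma unit_orthogonality:
  assumes "j < d" "k < d"
  shows "(\<Sum>x\<in>units. inverse x ^ (CARD('q) ^ j) * x ^ (CARD('q) ^ k)) = (if j = k then - 1 else 0)"
proof (cases "j = k")
  case True
  have "(\<Sum>x\<in>units. inverse x ^ (CARD('q) ^ k) * x ^ (CARD('q) ^ k)) = (\<Sum>x\<in>units. 1)"
    by (rule sum.cong) (auto simp flip: power_mult_distrib)
  also have "\<dots> = of_nat (CARD('q) ^ d - 1)"
    by (simp add: card_units)
  also have "\<dots> = - 1"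
    using CARD_power_d degree_pos by (simp add: of_nat_diff fq.CARD_eq_0 power_0_left)
  finally show ?thesis
    using True by simp
next
  case False
  define S where "S = (\<Sum>x\<in>units. inverse x ^ (CARD('q) ^ j) * x ^ (CARD('q) ^ k))"
  have neq: "\<zeta> ^ (CARD('q) ^ j) \<noteq> \<zeta> ^ (CARD('q) ^ k)"
    using False assms root_conjugates_inj by (auto simp: inj_on_def)
  then have z: "\<zeta> \<in> units"
    using residue_field_closed(3) by (auto simp: power_0_left)
  have inj: "inj_on ((*) \<zeta>) units"
    using z by (auto intro!: inj_onI)
  have "(*) \<zeta> ` units = units"
    using z by (intro endo_inj_surj inj) (auto intro: finite_residue_field residue_field_closed)
  then have "S = (\<Sum>x\<in>units. inverse (\<zeta> * x) ^ (CARD('q) ^ j) * (\<zeta> * x) ^ (CARD('q) ^ k))"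
    unfolding S_def using sum.reindex[OF inj, of "\<lambda>x. inverse x ^ (CARD('q) ^ j) * x ^ (CARD('q) ^ k)"] by simp
  also have "\<dots> = inverse (\<zeta> ^ (CARD('q) ^ j)) * \<zeta> ^ (CARD('q) ^ k) * S"
    by (simp add: S_def sum_distrib_left power_mult_distrib power_inverse mult_ac)
  finally have "\<zeta> ^ (CARD('q) ^ j) * S = \<zeta> ^ (CARD('q) ^ k) * S"
    using z by (simp add: field_simps)
  with neq show ?thesis
    using False by (simp add: S_def)
qed

lemma torsion_transform:
  assumes "j < d"
  shows "(\<Sum>x\<in>units. inverse x ^ (CARD('q) ^ j) * torsion x) =
         - (inverse (\<delta>\<^sub>p ^ (CARD('q) ^ j)) * omega \<iota> \<rho> (\<zeta> ^ (CARD('q) ^ j)))"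
proof -
  define c where "c k = inverse (\<delta>\<^sub>p ^ (CARD('q) ^ k)) * omega \<iota> \<rho> (\<zeta> ^ (CARD('q) ^ k))" for k
  have "(\<Sum>x\<in>units. inverse x ^ (CARD('q) ^ j) * torsion x) =
        (\<Sum>x\<in>units. \<Sum>k<d. inverse x ^ (CARD('q) ^ j) * x ^ (CARD('q) ^ k) * c k)"
    by (simp add: torsion_def c_def sum_distrib_left mult.assoc)
  also have "\<dots> = (\<Sum>k<d. \<Sum>x\<in>units. inverse x ^ (CARD('q) ^ j) * x ^ (CARD('q) ^ k) * c k)"
    by (rule sum.swap)
  also have "\<dots> = (\<Sum>k<d. if j = k then - c k else 0)"
    by (rule sum.cong) (simp_all add: unit_orthogonality assms flip: sum_distrib_right)
  finally show ?thesis
    using assms by (simp add: c_def)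
qed

lemma carlitz_module_0: "carlitz_module \<iota> a 0 = 0"
proof -
  have "((\<lambda>x. \<theta> * x + x ^ CARD('q)) ^^ i) 0 = 0" for i
    by (induction i) (simp_all add: power_0_left)
  then show ?thesis
    by (simp add: carlitz_module_def)
qed

text \<open>
  If \<open>M(1)\<close> were 0, then all \<open>M(x)\<close> would be, against the nonzero value of the sum in
  \<open>torsion_transform\<close>.
\<close>

lemma torsion_1_nonzero: "torsion 1 \<noteq> 0"
proof
  assume "torsion 1 = 0"
  then have "torsion x = 0" if "x \<in> units" for x
    using that carlitz_module_torsion[OF residue_field_closed(2)] carlitz_module_0
    by (auto simp: residue_field_def)
  then show False
    using torsion_transform[OF degree_pos] omega_nonzero[OF av_root_power[of 1]] value_pderiv_nonzero by simp
qed

lemma torsion_eq_0_iff: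
  assumes "x \<in> residue_field"
  shows "torsion x = 0 \<longleftrightarrow> x = 0"
proof (rule iffI, rule ccontr)
  assume "torsion x = 0" "x \<noteq> 0"
  moreover from this assms obtain a where a: "inverse x = val.ev a \<zeta>"
    using inverse_unit[of x] by (auto simp: residue_field_def)
  ultimately have "torsion 1 = 0"
    using carlitz_module_torsion[OF assms, of a] carlitz_module_0 by (simp flip: a)
  then show False
    using torsion_1_nonzero by simp
qed simp

lemma inj_on_torsion: "inj_on torsion residue_field"
  using torsion_eq_0_iff residue_field_closed(5) by (intro inj_onI) (metis eq_iff_diff_eq_0 torsion_diff)

end

section \<open>Gauss's lemma and Eisenstein's criterion\<close>

text \<open>
  Gauss's lemma in the form that a factorisation over the field of fractions, whose denominator \<open>c\<close> has been
  cleared, can be corrected to one over the ring of polynomials itself, with factors of the same degrees. The prime factors of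
  \<open>c\<close> are cancelled one by one.
\<close>

lemma gauss_factor_through_constant:
  fixes F f g :: "'a::field poly poly"
  assumes "smult c F = f * g" "c \<noteq> 0"
  shows "\<exists>f' g'. F = f' * g' \<and> degree f' = degree f \<and> degree g' = degree g"
  using assms
proof (induction "degree c" arbitrary: c F f g rule: less_induct)
  case (less c)
  consider "is_unit c" | "Factorial_Ring.irreducible c" | "\<not> is_unit c" "\<not> Factorial_Ring.irreducible c"
    by blast
  then show ?case
  proof cases
    case 1
    then obtain u where u: "1 = c * u"
      by (elim dvdE)
    then have "u \<noteq> 0"
      by auto
    have "F = smult u (smult c F)"
      using u by (simp add: mult.commute)
    then have "F = smult u f * g"
      by (simp add: less.prems)
    then show ?thesis
      using \<open>u \<noteq> 0\<close> by (intro exI[of _ "smult u f"] exI[of _ g]) simp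
  next
    case 2
    then have prime: "prime_elem [:c:]"
      by (intro lift_prime_elem_poly field_poly_irreducible_imp_prime)
    have "[:c:] * F = f * g"
      using less.prems by simp
    then have "[:c:] dvd f * g"
      by (metis dvd_triv_left)
    then have "[:c:] dvd f \<or> [:c:] dvd g"
      using prime prime_elem_dvd_multD by blast
    then show ?thesis
    proof
      assume "[:c:] dvd f"
      then obtain f' where f': "f = [:c:] * f'" ..
      with less.prems have "smult c F = smult c (f' * g)"
        by simp
      then have "F = f' * g"
        using less.prems(2) smult_cancel[of c] by blast
      then show ?thesis
        using f' less.prems(2) by (intro exI[of _ f'] exI[of _ g]) simp
    next
      assume "[:c:] dvd g"
      then obtain g' where g': "g = [:c:] * g'" ..
      with less.prems have "smult c F = smult c (f * g')"
        by simp
      then have "F = f * g'"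
        using less.prems(2) smult_cancel[of c] by blast
      then show ?thesis
        using g' less.prems(2) by (intro exI[of _ f] exI[of _ g']) simp
    qed
  next
    case 3
    then obtain a b where ab: "c = a * b" "\<not> is_unit a" "\<not> is_unit b"
      using less.prems(2) unfolding Factorial_Ring.irreducible_def by blast
    then have "a \<noteq> 0" "b \<noteq> 0" "degree a > 0" "degree b > 0"
      using less.prems(2) is_unit_iff_degree[of a] is_unit_iff_degree[of b] by auto
    then have deg: "degree a < degree c" "degree b < degree c"
      by (simp_all add: ab degree_mult_eq)
    have "smult a (smult b F) = f * g"
      using less.prems by (simp add: ab)
    from less.hyps[OF deg(1) this \<open>a \<noteq> 0\<close>] obtain f1 g1 where 1:
      "smult b F = f1 * g1" "degree f1 = degree f" "degree g1 = degree g"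
      by blast
    from less.hyps[OF deg(2) 1(1) \<open>b \<noteq> 0\<close>] 1(2,3) show ?thesis
      by simp
  qed
qed

text \<open>
  At the first coefficient of \<open>f\<close> that is not divisible by \<open>p\<close>, the product \<open>f g\<close> has a
  coefficient that is not divisible by \<open>p\<close>.
\<close>

lemma eisenstein_degree_le:
  fixes F f g :: "'a::comm_ring_1 poly"
  assumes p: "prime_elem p" and F: "F = f * g"
    and low: "\<And>k. k < N \<Longrightarrow> p dvd coeff F k"
    and f: "\<not> p dvd lead_coeff f" and g: "\<not> p dvd coeff g 0"
  shows "N \<le> degree f"
proof -
  define i where "i = (LEAST i. \<not> p dvd coeff f i)"
  have i: "\<not> p dvd coeff f i"
    unfolding i_def using f by (rule LeastI)
  have below: "p dvd coeff f j" if "j < i" for j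
    using that not_less_Least unfolding i_def by blast
  have "N \<le> i"
  proof (rule ccontr)
    assume "\<not> N \<le> i"
    then have "p dvd coeff F i"
      by (intro low) simp
    also have "coeff F i = (\<Sum>j<i. coeff f j * coeff g (i - j)) + coeff f i * coeff g 0"
      by (simp add: F coeff_mult flip: lessThan_Suc_atMost)
    finally have "p dvd coeff f i * coeff g 0"
      using below by (subst (asm) dvd_add_right_iff) (auto intro!: dvd_sum)
    with p i g show False
      using prime_elem_dvd_multD by blast
  qed
  also have "i \<le> degree f"
    unfolding i_def using f by (rule Least_le)
  finally show ?thesis .
qed

lemma eisenstein:
  fixes F f g :: "'a::idom poly"
  assumes p: "prime_elem p" and F: "F = f * g" and lead: "lead_coeff F = 1"
    and low: "\<And>k. k < degree F \<Longrightarrow> p dvd coeff F k" and c0: "\<not> p * p dvd coeff F 0"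
  shows "degree f = 0 \<or> degree g = 0"
proof -
  have "\<not> p dvd 1"
    using p by (simp add: prime_elem_def)
  have "lead_coeff f * lead_coeff g = 1"
    using lead F by (simp add: lead_coeff_mult)
  with \<open>\<not> p dvd 1\<close> have lf: "\<not> p dvd lead_coeff f" "\<not> p dvd lead_coeff g"
    by (metis dvd_mult2 dvd_mult)+
  have "F \<noteq> 0" using lead by auto
  then have deg: "degree F = degree f + degree g"
    using F by (auto simp: degree_mult_eq)
  have "coeff F 0 = coeff f 0 * coeff g 0"
    by (simp add: F coeff_mult_0)
  with c0 have "\<not> (p dvd coeff f 0 \<and> p dvd coeff g 0)"
    using mult_dvd_mono by auto
  then consider "\<not> p dvd coeff g 0" | "\<not> p dvd coeff f 0"
    by blast
  then show ?thesis
  proof cases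
    case 1
    have "degree F \<le> degree f"
      by (rule eisenstein_degree_le[OF p F low lf(1) 1])
    then show ?thesis
      using deg by simp
  next
    case 2
    have "F = g * f"
      using F by (simp add: mult.commute)
    have "degree F \<le> degree g"
      by (rule eisenstein_degree_le[OF p \<open>F = g * f\<close> low lf(2) 2])
    then show ?thesis
      using deg by simp
  qed
qed

section \<open>The coefficients of Carlitz's module\<close>

interpretation poly_fq: finite_field_algebra "\<lambda>c::'q::{field,finite}. [:c:]"
  by standard (simp_all add: one_pCons)

abbreviation \<T> :: "'a::comm_ring_1 poly" where "\<T> \<equiv> [:0, 1:]"

text \<open>
  The additive polynomial \<open>\<Sum>i. s i * X ^ (q ^ i)\<close> over \<open>A\<close> is encoded by its coefficient sequence \<open>s\<close>. The step composes it with \<open>\<phi>\<^sub>\<theta>\<close> on the right, that is, replaces \<open>X\<close> by \<open>\<theta> X + X\<^sup>q\<close>.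
\<close>

definition carlitz_step :: "(nat \<Rightarrow> 'q::{field,finite} poly) \<Rightarrow> nat \<Rightarrow> 'q poly" where
  "carlitz_step s i = \<T> ^ (CARD('q) ^ i) * s i + (if i = 0 then 0 else s (i - 1))"

definition carlitz_monomial_coeff :: "nat \<Rightarrow> nat \<Rightarrow> 'q::{field,finite} poly" where
  "carlitz_monomial_coeff n = (carlitz_step ^^ n) (\<lambda>i. if i = 0 then 1 else 0)"

definition carlitz_coeff :: "'q::{field,finite} poly \<Rightarrow> nat \<Rightarrow> 'q poly" where
  "carlitz_coeff a i = (\<Sum>n\<le>degree a. smult (coeff a n) (carlitz_monomial_coeff n i))"

lemma carlitz_monomial_coeff_0: "carlitz_monomial_coeff 0 i = (if i = 0 then 1 else 0)"
  by (simp add: carlitz_monomial_coeff_def)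

lemma carlitz_monomial_coeff_Suc:
  "carlitz_monomial_coeff (Suc n) i = \<T> ^ (CARD('q) ^ i) * carlitz_monomial_coeff n i
     + (if i = 0 then 0 else carlitz_monomial_coeff n (i - 1) :: 'q::{field,finite} poly)"
  by (simp add: carlitz_monomial_coeff_def carlitz_step_def)

text \<open>
  Composition with \<open>\<phi>\<^sub>\<theta>\<close> on the left. Both compositions give the same result since powers of
  \<open>\<phi>\<^sub>\<theta>\<close> commute with \<open>\<phi>\<^sub>\<theta>\<close>.
\<close>

lemma carlitz_monomial_coeff_Suc':
  "carlitz_monomial_coeff (Suc n) i = \<T> * carlitz_monomial_coeff n i
     + (if i = 0 then 0 else carlitz_monomial_coeff n (i - 1) ^ CARD('q) :: 'q::{field,finite} poly)"
proof (induction n arbitrary: i)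
  case 0
  then show ?case
    by (auto simp: carlitz_monomial_coeff_Suc carlitz_monomial_coeff_0 power_0_left)
next
  case (Suc n)
  let ?g = "carlitz_monomial_coeff :: nat \<Rightarrow> nat \<Rightarrow> 'q poly"
  have frob_add: "(a + b) ^ CARD('q) = a ^ CARD('q) + b ^ CARD('q)" for a b :: "'q poly"
    by (rule poly_fq.frob_add)
  have pow: "(\<T> ^ (CARD('q) ^ j)) ^ CARD('q) = (\<T> :: 'q poly) ^ (CARD('q) ^ Suc j)" for j
    by (simp add: mult.commute flip: power_mult)
  show ?case
  proof (cases i)
    case 0
    then show ?thesis
      using Suc[of 0] by (simp add: carlitz_monomial_coeff_Suc)
  next
    case i: (Suc j)
    have "?g (Suc (Suc n)) i = \<T> ^ (CARD('q) ^ i) * ?g (Suc n) i + ?g (Suc n) j"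
      by (subst carlitz_monomial_coeff_Suc) (simp add: i)
    also have "\<dots> = \<T> ^ (CARD('q) ^ i) * (\<T> * ?g n i + ?g n j ^ CARD('q))
        + (\<T> * ?g n j + (if j = 0 then 0 else ?g n (j - 1) ^ CARD('q)))"
      by (simp only: Suc) (simp add: i)
    also have "\<dots> = \<T> * (\<T> ^ (CARD('q) ^ i) * ?g n i + ?g n j)
        + (\<T> ^ (CARD('q) ^ j) * ?g n j + (if j = 0 then 0 else ?g n (j - 1))) ^ CARD('q)"
      unfolding frob_add power_mult_distrib pow i by (simp add: algebra_simps power_0_left del: mult_pCons_left mult_pCons_right)
    also have "\<dots> = \<T> * ?g (Suc n) i + ?g (Suc n) j ^ CARD('q)"
      unfolding carlitz_monomial_coeff_Suc[of n i] carlitz_monomial_coeff_Suc[of n j] by (simp add: i)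
    finally show ?thesis
      by (simp add: i)
  qed
qed

lemma carlitz_monomial_coeff_above: "n < i \<Longrightarrow> carlitz_monomial_coeff n i = 0"
  by (induction n arbitrary: i) (auto simp: carlitz_monomial_coeff_0 carlitz_monomial_coeff_Suc)

lemma carlitz_monomial_coeff_diag: "carlitz_monomial_coeff n n = 1"
  by (induction n) (simp_all add: carlitz_monomial_coeff_0 carlitz_monomial_coeff_Suc carlitz_monomial_coeff_above)

lemma carlitz_monomial_coeff_at_0: "carlitz_monomial_coeff n 0 = monom 1 n"
  by (induction n) (simp_all add: carlitz_monomial_coeff_0 carlitz_monomial_coeff_Suc monom_Suc monom_0 flip: one_pCons)

lemma carlitz_coeff_0: "carlitz_coeff a 0 = a"
  by (simp add: carlitz_coeff_def carlitz_monomial_coeff_at_0 smult_monom poly_as_sum_of_monoms)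

lemma carlitz_coeff_degree: "carlitz_coeff a (degree a) = [:lead_coeff a:]"
proof -
  have "carlitz_coeff a (degree a) = (\<Sum>n\<in>{degree a}. smult (coeff a n) (carlitz_monomial_coeff n (degree a)))"
    unfolding carlitz_coeff_def
    by (rule sum.mono_neutral_right) (auto simp: carlitz_monomial_coeff_above)
  then show ?thesis
    by (simp add: carlitz_monomial_coeff_diag)
qed

text \<open>
  The difference of the two ways to write \<open>\<phi>\<^sub>\<theta> \<phi>\<^sub>a = \<phi>\<^sub>a \<phi>\<^sub>\<theta>\<close>, coefficient by coefficient. It carries
  divisibility by \<open>p\<close> from one coefficient to the next.
\<close>

lemma carlitz_coeff_recurrence:
  fixes a :: "'q::{field,finite} poly"
  assumes "i > 0"
  shows "(\<T> ^ (CARD('q) ^ i) - \<T>) * carlitz_coeff a i = carlitz_coeff a (i - 1) ^ CARD('q) - carlitz_coeff a (i - 1)"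
proof -
  have mono: "(\<T> ^ (CARD('q) ^ i) - \<T>) * carlitz_monomial_coeff n i
      = carlitz_monomial_coeff n (i - 1) ^ CARD('q) - (carlitz_monomial_coeff n (i - 1) :: 'q poly)" for n
    using assms carlitz_monomial_coeff_Suc[of n i, where ?'q = 'q] carlitz_monomial_coeff_Suc'[of n i, where ?'q = 'q]
    by (simp add: algebra_simps del: mult_pCons_left mult_pCons_right)
  have "(\<T> ^ (CARD('q) ^ i) - \<T>) * carlitz_coeff a i = (\<Sum>n\<le>degree a. smult (coeff a n)
      (carlitz_monomial_coeff n (i - 1) ^ CARD('q) - carlitz_monomial_coeff n (i - 1)))"
    unfolding carlitz_coeff_def sum_distrib_left mult_smult_right by (simp only: mono)
  moreover have "carlitz_coeff a (i - 1) ^ CARD('q) =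
      (\<Sum>n\<le>degree a. smult (coeff a n) (carlitz_monomial_coeff n (i - 1) ^ CARD('q)))"
    using poly_fq.frob_power_sum[of "\<lambda>n. smult (coeff a n) (carlitz_monomial_coeff n (i - 1))" "{..degree a}" 1]
    by (simp add: carlitz_coeff_def smult_power finite_field_power_CARD)
  ultimately show ?thesis
    by (simp add: carlitz_coeff_def smult_diff_right sum_subtractf)
qed

section \<open>Transfer of polynomial equations between torsion points\<close>

context carlitz_prime
begin

sublocale pol: ring_hom_eval "\<lambda>a. val.ev a \<theta>"
  by standard (simp_all add: val.ev_add val.ev_mult)

lemma carlitz_module_eq_sum:
  "carlitz_module \<iota> a c = (\<Sum>i\<le>degree a. val.ev (carlitz_coeff a i) \<theta> * c ^ (CARD('q) ^ i))"
proof -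
  let ?g = "\<lambda>n i. val.ev (carlitz_monomial_coeff n i) \<theta>"
  have iter: "((\<lambda>x. \<theta> * x + x ^ CARD('q)) ^^ n) c = (\<Sum>i\<le>n. ?g n i * c ^ (CARD('q) ^ i))" for n
  proof (induction n)
    case 0
    then show ?case
      by (simp add: carlitz_monomial_coeff_0)
  next
    case (Suc n)
    have frob_sum: "(\<Sum>i\<le>n. f i) ^ CARD('q) = (\<Sum>i\<le>n. f i ^ CARD('q))" for f :: "nat \<Rightarrow> 'c"
      using fq.frob_power_sum[of f "{..n}" 1] by simp
    have pow: "(c ^ (CARD('q) ^ i)) ^ CARD('q) = c ^ (CARD('q) ^ Suc i)" for i
      by (simp add: mult.commute flip: power_mult)
    have "((\<lambda>x. \<theta> * x + x ^ CARD('q)) ^^ Suc n) c =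
        \<theta> * (\<Sum>i\<le>n. ?g n i * c ^ (CARD('q) ^ i)) + (\<Sum>i\<le>n. ?g n i ^ CARD('q) * c ^ (CARD('q) ^ Suc i))"
      by (simp add: Suc frob_sum power_mult_distrib pow del: power_Suc)
    also have "\<theta> * (\<Sum>i\<le>n. ?g n i * c ^ (CARD('q) ^ i)) = (\<Sum>i\<le>Suc n. \<theta> * ?g n i * c ^ (CARD('q) ^ i))"
      by (simp add: sum_distrib_left carlitz_monomial_coeff_above mult.assoc)
    also have "(\<Sum>i\<le>n. ?g n i ^ CARD('q) * c ^ (CARD('q) ^ Suc i)) =
        (\<Sum>i\<le>Suc n. (if i = 0 then 0 else ?g n (i - 1) ^ CARD('q)) * c ^ (CARD('q) ^ i))"
      by (simp add: sum.atMost_Suc_shift del: sum.atMost_Suc power_Suc)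
    also have "(\<Sum>i\<le>Suc n. \<theta> * ?g n i * c ^ (CARD('q) ^ i)) +
        (\<Sum>i\<le>Suc n. (if i = 0 then 0 else ?g n (i - 1) ^ CARD('q)) * c ^ (CARD('q) ^ i)) =
        (\<Sum>i\<le>Suc n. ?g (Suc n) i * c ^ (CARD('q) ^ i))"
      unfolding sum.distrib[symmetric]
      by (rule sum.cong) (simp_all add: carlitz_monomial_coeff_Suc' val.ev_add val.ev_mult val.ev_power
            const_hom fq.h_0 distrib_right del: mult_pCons_left mult_pCons_right)
    finally show ?case .
  qed
  have iter': "((\<lambda>x. \<theta> * x + x ^ CARD('q)) ^^ n) c = (\<Sum>i\<le>degree a. ?g n i * c ^ (CARD('q) ^ i))"
    if "n \<le> degree a" for n
    unfolding iter using that by (intro sum.mono_neutral_left) (auto simp: carlitz_monomial_coeff_above)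
  have "carlitz_module \<iota> a c = (\<Sum>n\<le>degree a. \<Sum>i\<le>degree a. const (coeff a n) * (?g n i * c ^ (CARD('q) ^ i)))"
    unfolding carlitz_module_def by (simp add: iter' sum_distrib_left flip: const_def)
  also have "\<dots> = (\<Sum>i\<le>degree a. \<Sum>n\<le>degree a. const (coeff a n) * (?g n i * c ^ (CARD('q) ^ i)))"
    by (rule sum.swap)
  finally show ?thesis
    by (simp add: carlitz_coeff_def val.ev_sum val.ev_smult sum_distrib_right mult.assoc)
qed

text \<open>
  Reduce the recurrence modulo \<open>p\<close> by evaluating at \<open>\<zeta>\<close>: the factor on its left becomes a difference of distinct
  conjugates of \<open>\<zeta>\<close>, so divisibility propagates from the coefficient \<open>p\<close> of \<open>X\<close> up to index \<open>d - 1\<close>.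
\<close>

lemma prime_dvd_carlitz_coeff: "i < d \<Longrightarrow> p dvd carlitz_coeff p i"
proof (induction i)
  case 0
  show ?case
    by (simp add: carlitz_coeff_0)
next
  case (Suc i)
  then have IH: "val.ev (carlitz_coeff p i) \<zeta> = 0"
    by (simp add: value_root_eq_0_iff)
  have T: "val.ev \<T> \<zeta> = \<zeta>"
    by (simp add: const_hom fq.h_0)
  have "val.ev ((\<T> ^ (CARD('q) ^ Suc i) - \<T>) * carlitz_coeff p (Suc i)) \<zeta> = 0"
    using carlitz_coeff_recurrence[of "Suc i" p] IH
    by (simp only: val.ev_diff val.ev_power) (simp add: val.ev_diff val.ev_power power_0_left)
  then have "(\<zeta> ^ (CARD('q) ^ Suc i) - \<zeta>) * val.ev (carlitz_coeff p (Suc i)) \<zeta> = 0"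
    by (simp only: val.ev_mult val.ev_diff val.ev_power T)
  moreover have "\<zeta> ^ (CARD('q) ^ Suc i) \<noteq> \<zeta> ^ (CARD('q) ^ 0)"
    using inj_on_eq_iff[OF root_conjugates_inj, of "Suc i" 0] Suc.prems by (simp del: power_Suc)
  ultimately show ?case
    by (simp add: value_root_eq_0_iff)
qed

text \<open>
  The polynomial \<open>\<phi>\<^sub>p(X)/X\<close>, which is monic of degree \<open>q\<^sup>d - 1\<close>.
\<close>

definition torsion_poly :: "'q poly poly" where
  "torsion_poly = (\<Sum>i\<le>d. monom (carlitz_coeff p i) (CARD('q) ^ i - 1))"

lemma coeff_torsion_poly:
  "coeff torsion_poly k = (\<Sum>i\<le>d. if CARD('q) ^ i - 1 = k then carlitz_coeff p i else 0)"
  by (simp add: torsion_poly_def coeff_sum)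

lemma CARD_power_less: "i < j \<Longrightarrow> CARD('q) ^ i < CARD('q) ^ j"
  using CARD_ge_2 by (intro power_strict_increasing) auto

lemma CARD_power_pos: "CARD('q) ^ i > 0"
  using CARD_ge_2 by simp

lemma coeff_torsion_poly_top: "coeff torsion_poly (CARD('q) ^ d - 1) = 1"
proof -
  have "CARD('q) ^ i - 1 \<noteq> CARD('q) ^ d - 1" if "i < d" for i
    using CARD_power_less[OF that] CARD_power_pos[of i] by linarith
  then have "coeff torsion_poly (CARD('q) ^ d - 1) = (\<Sum>i\<in>{d}. carlitz_coeff p i)"
    unfolding coeff_torsion_poly by (intro sum.mono_neutral_cong_right) (auto simp: le_less)
  then show ?thesis
    using monic by (simp add: carlitz_coeff_degree one_pCons)
qed

lemma coeff_torsion_poly_above: "k > CARD('q) ^ d - 1 \<Longrightarrow> coeff torsion_poly k = 0"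
proof -
  assume k: "k > CARD('q) ^ d - 1"
  have "CARD('q) ^ i - 1 \<noteq> k" if "i \<le> d" for i
  proof -
    have "CARD('q) ^ i \<le> CARD('q) ^ d"
      using that CARD_ge_2 by (intro power_increasing) auto
    with k show ?thesis
      by linarith
  qed
  then show ?thesis
    unfolding coeff_torsion_poly by (intro sum.neutral) auto
qed

lemma degree_torsion_poly: "degree torsion_poly = CARD('q) ^ d - 1"
proof (rule antisym)
  show "degree torsion_poly \<le> CARD('q) ^ d - 1"
    by (intro degree_le allI impI coeff_torsion_poly_above)
  show "CARD('q) ^ d - 1 \<le> degree torsion_poly"
    by (rule le_degree) (simp only: coeff_torsion_poly_top one_neq_zero not_False_eq_True)
qed

lemma coeff_torsion_poly_low:
  assumes "k < CARD('q) ^ d - 1"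
  shows "p dvd coeff torsion_poly k"
  unfolding coeff_torsion_poly
proof (rule dvd_sum)
  fix i assume "i \<in> {..d}"
  then show "p dvd (if CARD('q) ^ i - 1 = k then carlitz_coeff p i else 0)"
    using assms prime_dvd_carlitz_coeff[of i] by (cases "i = d") auto
qed

lemma coeff_torsion_poly_0: "coeff torsion_poly 0 = p"
proof -
  have "CARD('q) ^ i - 1 \<noteq> 0" if "i > 0" for i
    using CARD_power_less[OF that] by simp
  then have "coeff torsion_poly 0 = (\<Sum>i\<in>{0}. carlitz_coeff p i)"
    unfolding coeff_torsion_poly by (intro sum.mono_neutral_cong_right) auto
  then show ?thesis
    by (simp add: carlitz_coeff_0)
qed

lemma value_torsion_poly: "c * pol.ev torsion_poly c = carlitz_module \<iota> p c"
proof -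
  have "c * (val.ev a \<theta> * c ^ (CARD('q) ^ i - 1)) = val.ev a \<theta> * c ^ (CARD('q) ^ i)" for a i
    using power_minus_mult[OF CARD_power_pos[of i], of c] by (metis mult.left_commute mult.commute)
  then show ?thesis
    by (simp only: torsion_poly_def pol.ev_sum pol.ev_monom carlitz_module_eq_sum sum_distrib_left)
qed

lemma torsion_poly_root:
  assumes "x \<in> units"
  shows "pol.ev torsion_poly (torsion x) = 0"
proof -
  have "torsion x * pol.ev torsion_poly (torsion x) = 0"
    using assms carlitz_module_torsion[of x p] by (simp add: value_torsion_poly root)
  then show ?thesis
    using assms torsion_eq_0_iff[of x] by auto
qed

text \<open>
  A nonzero polynomial over \<open>A\<close> of least degree that vanishes at \<open>M(1)\<close> divides \<open>torsion_poly\<close> up to a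
  constant, by pseudo-division. Gauss's lemma removes the constant, and by Eisenstein's criterion the
  factorisation is trivial.
\<close>

lemma torsion_poly_minimal:
  assumes "pol.ev f (torsion 1) = 0" "degree f < CARD('q) ^ d - 1"
  shows "f = 0"
proof (rule ccontr)
  assume "f \<noteq> 0"
  then obtain f0 where f0: "f0 \<noteq> 0" "pol.ev f0 (torsion 1) = 0" "degree f0 \<le> degree f"
    and least: "\<And>g. g \<noteq> 0 \<Longrightarrow> pol.ev g (torsion 1) = 0 \<Longrightarrow> degree f0 \<le> degree g"
    using ex_has_least_nat[of "\<lambda>g. g \<noteq> 0 \<and> pol.ev g (torsion 1) = 0" f degree] assms(1) by blast
  define r where "r = pseudo_mod torsion_poly f0"
  obtain c g where c: "c \<noteq> 0" "smult c torsion_poly = f0 * g + r"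
    using pseudo_mod(1)[OF f0(1), of torsion_poly] by (auto simp: r_def)
  have "1 \<in> units"
    using residue_field_closed by simp
  then have "pol.ev torsion_poly (torsion 1) = 0"
    by (rule torsion_poly_root)
  then have "pol.ev (f0 * g + r) (torsion 1) = 0"
    by (simp only: c(2)[symmetric] pol.ev_smult) simp
  then have "pol.ev r (torsion 1) = 0"
    by (simp add: pol.ev_add pol.ev_mult f0)
  moreover have "r = 0 \<or> degree r < degree f0"
    unfolding r_def by (rule pseudo_mod(2)[OF f0(1)])
  ultimately have "r = 0"
    using least[of r] by (meson leD)
  then have "smult c torsion_poly = f0 * g"
    using c by simp
  from gauss_factor_through_constant[OF this c(1)] obtain f' g' where
    fg: "torsion_poly = f' * g'" "degree f' = degree f0" "degree g' = degree g"
    by blast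
  have prime: "prime_elem p"
    using irred by (rule field_poly_irreducible_imp_prime)
  have "\<not> p * p dvd p"
  proof
    assume "p * p dvd p"
    then have "degree (p * p) \<le> d"
      using p_nonzero by (rule dvd_imp_degree_le)
    then show False
      using degree_pos p_nonzero by (simp add: degree_mult_eq)
  qed
  then have "degree f' = 0 \<or> degree g' = 0"
  proof (intro eisenstein[OF prime fg(1)])
    show "lead_coeff torsion_poly = 1"
      by (simp only: degree_torsion_poly coeff_torsion_poly_top)
    show "p dvd coeff torsion_poly k" if "k < degree torsion_poly" for k
      using that by (intro coeff_torsion_poly_low) (simp only: degree_torsion_poly)
    show "\<not> p * p dvd coeff torsion_poly 0"
      using \<open>\<not> p * p dvd p\<close> by (simp only: coeff_torsion_poly_0 not_False_eq_True)
  qed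
  moreover have "degree f' \<noteq> 0"
  proof
    assume "degree f' = 0"
    then obtain b where "f0 = [:b:]"
      using fg by (auto elim: degree_eq_zeroE)
    with f0 show False
      by simp
  qed
  ultimately have "degree g' = 0"
    by simp
  moreover have "f' \<noteq> 0" "g' \<noteq> 0"
    using fg(1) coeff_torsion_poly_top by auto
  ultimately have "degree f0 = CARD('q) ^ d - 1"
    using fg degree_torsion_poly by (simp add: degree_mult_eq)
  then show False
    using f0(3) assms(2) by simp
qed

lemma torsion_root_transfer:
  assumes "pol.ev f (torsion 1) = 0" "x \<in> units"
  shows "pol.ev f (torsion x) = 0"
proof -
  have "1 \<in> units"
    using residue_field_closed by simp
  have "torsion_poly \<noteq> 0"
    using coeff_torsion_poly_top by auto
  define r where "r = pseudo_mod f torsion_poly"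
  obtain c g where c: "c \<noteq> 0" "smult c f = torsion_poly * g + r"
    using pseudo_mod(1)[OF \<open>torsion_poly \<noteq> 0\<close>, of f] by (auto simp: r_def)
  have ev: "val.ev c \<theta> * pol.ev f y = pol.ev torsion_poly y * pol.ev g y + pol.ev r y" for y
    by (metis c(2) pol.ev_add pol.ev_mult pol.ev_smult)
  have "pol.ev r (torsion 1) = 0"
    using ev[of "torsion 1"] assms(1) torsion_poly_root[OF \<open>1 \<in> units\<close>] by simp
  then have "r = 0"
    using torsion_poly_minimal pseudo_mod(2)[OF \<open>torsion_poly \<noteq> 0\<close>, of f]
    by (auto simp: r_def degree_torsion_poly)
  then show ?thesis
    using ev[of "torsion x"] torsion_poly_root[OF assms(2)] c(1) by simp
qed

definition carlitz_poly :: "'q poly \<Rightarrow> 'q poly poly" where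
  "carlitz_poly a = (\<Sum>i\<le>degree a. monom (carlitz_coeff a i) (CARD('q) ^ i))"

lemma value_carlitz_poly: "pol.ev (carlitz_poly a) c = carlitz_module \<iota> a c"
  by (simp add: carlitz_poly_def pol.ev_sum pol.ev_monom carlitz_module_eq_sum)

lemma value_pcompose: "pol.ev (pcompose f g) c = pol.ev f (pol.ev g c)"
  by (induction f) (simp_all add: pcompose_pCons pol.ev_add pol.ev_mult)

text \<open>
  The converse transfers the equation \<open>f(\<phi>\<^sub>a(X)) = 0\<close>, where \<open>x = a(\<zeta>)\<close>, from \<open>M(1)\<close> to \<open>M\<close> of the inverse of \<open>x\<close>.
\<close>

lemma torsion_root_transfer_iff:
  assumes "x \<in> units"
  shows "pol.ev f (torsion x) = 0 \<longleftrightarrow> pol.ev f (torsion 1) = 0"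
proof
  assume f: "pol.ev f (torsion x) = 0"
  obtain a where a: "x = val.ev a \<zeta>"
    using assms by (auto simp: residue_field_def)
  define g where "g = pcompose f (carlitz_poly a)"
  have g: "pol.ev g (torsion y) = pol.ev f (torsion (x * y))" if "y \<in> residue_field" for y
    using that by (simp add: g_def value_pcompose value_carlitz_poly carlitz_module_torsion a)
  have "pol.ev g (torsion 1) = 0"
    using f g[of 1] residue_field_closed(2) by simp
  then have "pol.ev g (torsion (inverse x)) = 0"
    by (rule torsion_root_transfer[OF _ inverse_unit[OF assms]])
  then show "pol.ev f (torsion 1) = 0"
    using g[of "inverse x"] inverse_unit[OF assms] assms by auto
qed (use assms torsion_root_transfer in blast)

end

section \<open>The Galois group\<close>

lemma ring_of_type_algebra_simps [simp]:
  "carrier ring_of_type_algebra = UNIV"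
  "monoid.mult ring_of_type_algebra x y = x * y"
  "monoid.one ring_of_type_algebra = 1"
  "ring.zero ring_of_type_algebra = 0"
  "ring.add ring_of_type_algebra x y = x + y"
  by (simp_all add: ring_of_type_algebra_def)

lemma ring_of_type_algebra_uminus: "a_inv ring_of_type_algebra x = - (x :: 'a::field)"
proof -
  interpret R: field "ring_of_type_algebra :: 'a ring"
    by (rule field_from_type_algebra)
  show ?thesis
    by (rule R.minus_equality) simp_all
qed

lemma ring_of_type_algebra_inverse:
  assumes "x \<noteq> 0"
  shows "m_inv ring_of_type_algebra x = inverse (x :: 'a::field)"
proof -
  interpret R: field "ring_of_type_algebra :: 'a ring"
    by (rule field_from_type_algebra)
  show ?thesis
    by (rule R.comm_inv_char) (use assms in simp_all)
qed

context carlitz_prime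
begin

text \<open>
  The field \<open>K(\<lambda>\<^sub>p)\<close>. Elements are written as quotients of values of polynomials over \<open>A\<close>, because the
  transfer of equations to \<open>M(x)\<close> then says that replacing \<open>M(1)\<close> by \<open>M(x)\<close> is well defined.
\<close>

definition torsion_field :: "'c set" where
  "torsion_field = {pol.ev f (torsion 1) / pol.ev g (torsion 1) | f g. pol.ev g (torsion 1) \<noteq> 0}"

lemma torsion_fieldI: "pol.ev g (torsion 1) \<noteq> 0 \<Longrightarrow> pol.ev f (torsion 1) / pol.ev g (torsion 1) \<in> torsion_field"
  by (auto simp: torsion_field_def)

lemma torsion_fieldE:
  assumes "y \<in> torsion_field"
  obtains f g where "pol.ev g (torsion 1) \<noteq> 0" "y = pol.ev f (torsion 1) / pol.ev g (torsion 1)"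
  using assms by (auto simp: torsion_field_def)

lemma value_in_torsion_field: "pol.ev f (torsion 1) \<in> torsion_field"
  using torsion_fieldI[of 1 f] by simp

lemma torsion_in_torsion_field:
  assumes "x \<in> residue_field"
  shows "torsion x \<in> torsion_field"
proof -
  obtain a where "x = val.ev a \<zeta>"
    using assms by (auto simp: residue_field_def)
  then have "torsion x = pol.ev (carlitz_poly a) (torsion 1)"
    using carlitz_module_torsion[OF residue_field_closed(2), of a] by (simp add: value_carlitz_poly)
  then show ?thesis
    by (simp add: value_in_torsion_field)
qed

lemma K_rat_altdef: "y \<in> K_rat \<iota> \<longleftrightarrow> (\<exists>a b. b \<noteq> 0 \<and> y = val.ev a \<theta> / val.ev b \<theta>)"
  by (auto simp: K_rat_def value_at_eq)

lemma value_theta_in_K_rat: "val.ev a \<theta> \<in> K_rat \<iota>"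
  unfolding K_rat_altdef by (rule exI[of _ a], rule exI[of _ 1]) simp

lemma K_rat_subset: "K_rat \<iota> \<subseteq> torsion_field"
proof
  fix y assume "y \<in> K_rat \<iota>"
  then obtain a b where "b \<noteq> 0" "y = val.ev a \<theta> / val.ev b \<theta>"
    by (auto simp: K_rat_altdef)
  then show "y \<in> torsion_field"
    using torsion_fieldI[of "[:b:]" "[:a:]"] by simp
qed

lemma torsion_field_closed:
  assumes "y \<in> torsion_field" "z \<in> torsion_field"
  shows "y + z \<in> torsion_field" "y * z \<in> torsion_field"
proof -
  obtain f g where y: "pol.ev g (torsion 1) \<noteq> 0" "y = pol.ev f (torsion 1) / pol.ev g (torsion 1)"
    using assms by (elim torsion_fieldE)
  obtain h k where z: "pol.ev k (torsion 1) \<noteq> 0" "z = pol.ev h (torsion 1) / pol.ev k (torsion 1)"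
    using assms by (elim torsion_fieldE)
  have "y + z = pol.ev (f * k + h * g) (torsion 1) / pol.ev (g * k) (torsion 1)"
    using y z by (simp add: pol.ev_add pol.ev_mult add_frac_eq)
  then show "y + z \<in> torsion_field"
    using y z torsion_fieldI[of "g * k" "f * k + h * g"] by (simp add: pol.ev_mult)
  have "y * z = pol.ev (f * h) (torsion 1) / pol.ev (g * k) (torsion 1)"
    using y z by (simp add: pol.ev_mult)
  then show "y * z \<in> torsion_field"
    using y z torsion_fieldI[of "g * k" "f * h"] by (simp add: pol.ev_mult)
qed

lemma torsion_field_uminus_inverse:
  assumes "y \<in> torsion_field"
  shows "- y \<in> torsion_field" "inverse y \<in> torsion_field"
proof -
  obtain f g where y: "pol.ev g (torsion 1) \<noteq> 0" "y = pol.ev f (torsion 1) / pol.ev g (torsion 1)"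
    using assms by (elim torsion_fieldE)
  show "- y \<in> torsion_field"
    using y torsion_fieldI[of g "- f"] by (simp add: pol.ev_uminus)
  show "inverse y \<in> torsion_field"
  proof (cases "y = 0")
    case True
    then show ?thesis
      using assms by simp
  next
    case False
    then show ?thesis
      using y torsion_fieldI[of f g] by simp
  qed
qed

lemma generate_field_torsion:
  "generate_field ring_of_type_algebra (K_rat \<iota> \<union> {torsion 1}) = torsion_field" (is "?G = _")
proof (intro equalityI subsetI)
  fix y assume "y \<in> ?G"
  then show "y \<in> torsion_field"
  proof induction
    case one
    then show ?case
      using value_in_torsion_field[of 1] by simp
  next
    case (incl h)
    then show ?case
      using K_rat_subset torsion_in_torsion_field[OF residue_field_closed(2)] by auto
  qed (auto simp: ring_of_type_algebra_uminus ring_of_type_algebra_inverse torsion_field_closed torsion_field_uminus_inverse)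
next
  fix y assume "y \<in> torsion_field"
  then obtain f g where y: "pol.ev g (torsion 1) \<noteq> 0" "y = pol.ev f (torsion 1) / pol.ev g (torsion 1)"
    by (elim torsion_fieldE)
  note gen_add = generate_field.eng_add[of _ "ring_of_type_algebra :: 'c ring", simplified]
  note gen_mult = generate_field.eng_mult[of _ "ring_of_type_algebra :: 'c ring", simplified]
  have ev: "pol.ev h (torsion 1) \<in> ?G" for h
  proof (induction h)
    case 0
    have "val.ev 0 \<theta> \<in> ?G"
      by (intro generate_field.incl UnI1 value_theta_in_K_rat)
    then show ?case
      by simp
  next
    case (pCons a h)
    have "val.ev a \<theta> \<in> ?G" "torsion 1 \<in> ?G"
      by (auto intro: generate_field.incl value_theta_in_K_rat)
    then show ?case
      using pCons by (simp add: gen_add gen_mult)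
  qed
  have "inverse (pol.ev g (torsion 1)) \<in> ?G"
    using generate_field.m_inv[OF ev[of g]] y(1) by (simp add: ring_of_type_algebra_inverse)
  then show "y \<in> ?G"
    using ev[of f] by (simp add: y(2) divide_inverse gen_mult)
qed

text \<open>A homomorphism over \<open>K\<close> is determined by the image of the generator \<open>M(1)\<close>.\<close>

lemma hom_over_K_value:
  assumes add: "\<And>y z. y \<in> torsion_field \<Longrightarrow> z \<in> torsion_field \<Longrightarrow> \<sigma> (y + z) = \<sigma> y + \<sigma> z"
    and mult: "\<And>y z. y \<in> torsion_field \<Longrightarrow> z \<in> torsion_field \<Longrightarrow> \<sigma> (y * z) = \<sigma> y * \<sigma> z"
    and fixes_K: "\<And>y. y \<in> K_rat \<iota> \<Longrightarrow> \<sigma> y = y"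
    and g: "pol.ev g (torsion 1) \<noteq> 0"
  shows "\<sigma> (pol.ev f (torsion 1) / pol.ev g (torsion 1)) = pol.ev f (\<sigma> (torsion 1)) / pol.ev g (\<sigma> (torsion 1))"
proof -
  have fix_value: "\<sigma> (val.ev a \<theta>) = val.ev a \<theta>" for a
    by (rule fixes_K[OF value_theta_in_K_rat])
  have ev: "\<sigma> (pol.ev h (torsion 1)) = pol.ev h (\<sigma> (torsion 1))" for h
  proof (induction h)
    case 0
    then show ?case
      using fix_value[of 0] by simp
  next
    case (pCons a h)
    have "val.ev a \<theta> \<in> torsion_field"
      using value_theta_in_K_rat K_rat_subset by blast
    then show ?case
      using pCons torsion_in_torsion_field[OF residue_field_closed(2)] value_in_torsion_field[of h]
      by (simp add: add mult fix_value torsion_field_closed)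
  qed
  have "\<sigma> (pol.ev g (torsion 1)) * \<sigma> (inverse (pol.ev g (torsion 1))) = \<sigma> 1"
    using g value_in_torsion_field[of g] by (subst mult[symmetric]) (simp_all add: torsion_field_uminus_inverse)
  also have "\<sigma> 1 = 1"
    using fix_value[of 1] by simp
  finally have "\<sigma> (inverse (pol.ev g (torsion 1))) = inverse (pol.ev g (\<sigma> (torsion 1)))"
    unfolding ev by (metis inverse_unique)
  then show ?thesis
    using value_in_torsion_field[of f] torsion_field_uminus_inverse(2)[OF value_in_torsion_field[of g]]
    by (simp add: divide_inverse mult ev)
qed

text \<open>
  The automorphism that takes \<open>M(1)\<close> to \<open>M(x)\<close>. It is restricted to \<open>torsion_field\<close> since members of the
  permutation group of a set are extensional functions.
\<close>

definition conjugation :: "'c \<Rightarrow> 'c \<Rightarrow> 'c" where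
  "conjugation x = (\<lambda>y\<in>torsion_field. THE z. \<exists>f g. pol.ev g (torsion 1) \<noteq> 0 \<and>
     y = pol.ev f (torsion 1) / pol.ev g (torsion 1) \<and> z = pol.ev f (torsion x) / pol.ev g (torsion x))"

text \<open>
  Well-definedness: two representations \<open>f/g\<close> and \<open>f'/g'\<close> agree at \<open>M(1)\<close> if and only if
  \<open>f g' - f' g\<close> vanishes there, and this transfers to \<open>M(x)\<close>.
\<close>

lemma conjugation_eq:
  assumes x: "x \<in> units" and g: "pol.ev g (torsion 1) \<noteq> 0"
  shows "conjugation x (pol.ev f (torsion 1) / pol.ev g (torsion 1)) = pol.ev f (torsion x) / pol.ev g (torsion x)"
proof -
  have "(THE z. \<exists>f' g'. pol.ev g' (torsion 1) \<noteq> 0 \<and>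
      pol.ev f (torsion 1) / pol.ev g (torsion 1) = pol.ev f' (torsion 1) / pol.ev g' (torsion 1) \<and>
      z = pol.ev f' (torsion x) / pol.ev g' (torsion x)) = pol.ev f (torsion x) / pol.ev g (torsion x)"
  proof (rule the_equality)
    fix z assume "\<exists>f' g'. pol.ev g' (torsion 1) \<noteq> 0 \<and>
      pol.ev f (torsion 1) / pol.ev g (torsion 1) = pol.ev f' (torsion 1) / pol.ev g' (torsion 1) \<and>
      z = pol.ev f' (torsion x) / pol.ev g' (torsion x)"
    then obtain f' g' where f'g': "pol.ev g' (torsion 1) \<noteq> 0"
      "pol.ev f (torsion 1) / pol.ev g (torsion 1) = pol.ev f' (torsion 1) / pol.ev g' (torsion 1)"
      "z = pol.ev f' (torsion x) / pol.ev g' (torsion x)"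
      by blast
    then have "pol.ev (f * g' - f' * g) (torsion 1) = 0"
      using g by (simp add: pol.ev_diff pol.ev_mult frac_eq_eq)
    then have "pol.ev (f * g' - f' * g) (torsion x) = 0"
      using x by (rule torsion_root_transfer)
    moreover have "pol.ev g (torsion x) \<noteq> 0" "pol.ev g' (torsion x) \<noteq> 0"
      using torsion_root_transfer_iff[OF x] g f'g'(1) by auto
    ultimately show "z = pol.ev f (torsion x) / pol.ev g (torsion x)"
      by (simp add: f'g'(3) pol.ev_diff pol.ev_mult frac_eq_eq)
  qed (use g in blast)
  then show ?thesis
    using torsion_fieldI[OF g] by (simp add: conjugation_def)
qed

lemma conjugation_value: "x \<in> units \<Longrightarrow> conjugation x (pol.ev f (torsion 1)) = pol.ev f (torsion x)"
  using conjugation_eq[of x 1 f] by simp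

lemma conjugation_torsion:
  assumes "x \<in> units" "y \<in> residue_field"
  shows "conjugation x (torsion y) = torsion (x * y)"
proof -
  obtain a where a: "y = val.ev a \<zeta>"
    using assms by (auto simp: residue_field_def)
  have ev: "pol.ev (carlitz_poly a) (torsion z) = torsion (y * z)" if "z \<in> residue_field" for z
    using that by (simp add: value_carlitz_poly carlitz_module_torsion a)
  show ?thesis
    using conjugation_value[OF assms(1), of "carlitz_poly a"] ev[of 1] ev[of x] assms residue_field_closed(2)
    by (simp add: mult.commute)
qed

lemma conjugation_comp:
  assumes x: "x \<in> units" and y: "y \<in> units" and z: "z \<in> torsion_field"
  shows "conjugation y z \<in> torsion_field \<and> conjugation x (conjugation y z) = conjugation (x * y) z"
proof -
  obtain f g where z: "pol.ev g (torsion 1) \<noteq> 0" "z = pol.ev f (torsion 1) / pol.ev g (torsion 1)"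
    using z by (elim torsion_fieldE)
  obtain a where a: "y = val.ev a \<zeta>"
    using y by (auto simp: residue_field_def)
  have ev: "pol.ev h (torsion (y * u)) = pol.ev (pcompose h (carlitz_poly a)) (torsion u)"
    if "u \<in> residue_field" for h u
    using that by (simp add: value_pcompose value_carlitz_poly carlitz_module_torsion a)
  have y_eq: "conjugation y z = pol.ev (pcompose f (carlitz_poly a)) (torsion 1) / pol.ev (pcompose g (carlitz_poly a)) (torsion 1)"
    using conjugation_eq[OF y z(1), of f] ev[of 1, OF residue_field_closed(2)] z(2) by simp
  have g0: "pol.ev (pcompose g (carlitz_poly a)) (torsion 1) \<noteq> 0"
    using torsion_root_transfer_iff[OF y, of g] z(1) ev[of 1 g, OF residue_field_closed(2)] by simp
  have "conjugation x (conjugation y z) = pol.ev f (torsion (y * x)) / pol.ev g (torsion (y * x))"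
    unfolding y_eq using conjugation_eq[OF x g0] ev[of x] x by simp
  also have "\<dots> = conjugation (x * y) z"
    using conjugation_eq[of "x * y" g f] x y z residue_field_closed(6) by (simp add: mult.commute)
  finally show ?thesis
    using torsion_fieldI[OF g0] by (simp add: y_eq)
qed

lemma conjugation_one: "z \<in> torsion_field \<Longrightarrow> conjugation 1 z = z"
  using conjugation_eq[of 1] residue_field_closed(2) by (elim torsion_fieldE) simp

lemma units_closed: "1 \<in> units" "x \<in> units \<Longrightarrow> y \<in> units \<Longrightarrow> x * y \<in> units"
  using residue_field_closed by auto

abbreviation \<Delta> :: "('c \<Rightarrow> 'c) monoid" where "\<Delta> \<equiv> Delta_p \<iota> \<rho> p"

lemma Delta_eq_galois_group: "\<Delta> = galois_group (K_rat \<iota>) torsion_field"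
  unfolding Delta_p_def lambda_eq_torsion generate_field_torsion ..

lemma carrier_Delta:
  "\<sigma> \<in> carrier \<Delta> \<longleftrightarrow> \<sigma> \<in> Bij torsion_field \<and>
     (\<forall>y\<in>torsion_field. \<forall>z\<in>torsion_field. \<sigma> (y + z) = \<sigma> y + \<sigma> z \<and> \<sigma> (y * z) = \<sigma> y * \<sigma> z) \<and>
     (\<forall>y\<in>K_rat \<iota>. \<sigma> y = y)"
proof -
  have "1 \<in> K_rat \<iota>"
    using value_theta_in_K_rat[of 1] by simp
  moreover have "\<sigma> y \<in> torsion_field" if "\<sigma> \<in> Bij torsion_field" "y \<in> torsion_field" for y
    using that Bij_imp_funcset by blast
  ultimately show ?thesis
    by (auto simp: Delta_eq_galois_group galois_group_def Let_def ring_hom_def)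
qed

lemma conjugation_in_Delta:
  assumes x: "x \<in> units"
  shows "conjugation x \<in> carrier \<Delta>"
  unfolding carrier_Delta
proof (intro conjI ballI)
  note x' = inverse_unit[OF x]
  have "bij_betw (conjugation x) torsion_field torsion_field"
  proof (rule bij_betw_byWitness[where f' = "conjugation (inverse x)"])
    show "\<forall>z\<in>torsion_field. conjugation (inverse x) (conjugation x z) = z"
      "\<forall>z\<in>torsion_field. conjugation x (conjugation (inverse x) z) = z"
      using conjugation_comp[OF x x'] conjugation_comp[OF x' x] x by (auto simp: conjugation_one)
    show "conjugation x ` torsion_field \<subseteq> torsion_field" "conjugation (inverse x) ` torsion_field \<subseteq> torsion_field"
      using conjugation_comp[OF x x'] conjugation_comp[OF x' x] by auto
  qed
  then show "conjugation x \<in> Bij torsion_field"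
    by (simp add: Bij_def conjugation_def)
next
  fix y z assume "y \<in> torsion_field" "z \<in> torsion_field"
  then obtain f g h k where
    y: "pol.ev g (torsion 1) \<noteq> 0" "y = pol.ev f (torsion 1) / pol.ev g (torsion 1)" and
    z: "pol.ev k (torsion 1) \<noteq> 0" "z = pol.ev h (torsion 1) / pol.ev k (torsion 1)"
    by (elim torsion_fieldE)
  have gk: "pol.ev (g * k) (torsion 1) \<noteq> 0" "pol.ev g (torsion x) \<noteq> 0" "pol.ev k (torsion x) \<noteq> 0"
    using y z torsion_root_transfer_iff[OF x] by (auto simp: pol.ev_mult)
  have conj_y: "conjugation x y = pol.ev f (torsion x) / pol.ev g (torsion x)"
    and conj_z: "conjugation x z = pol.ev h (torsion x) / pol.ev k (torsion x)"
    using conjugation_eq[OF x] y z by simp_all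
  have "y + z = pol.ev (f * k + h * g) (torsion 1) / pol.ev (g * k) (torsion 1)"
    using y z by (simp add: pol.ev_add pol.ev_mult add_frac_eq)
  then have "conjugation x (y + z) = pol.ev (f * k + h * g) (torsion x) / pol.ev (g * k) (torsion x)"
    by (simp only: conjugation_eq[OF x gk(1)])
  then show "conjugation x (y + z) = conjugation x y + conjugation x z"
    using gk by (simp add: conj_y conj_z pol.ev_add pol.ev_mult add_frac_eq)
  have "y * z = pol.ev (f * h) (torsion 1) / pol.ev (g * k) (torsion 1)"
    using y z by (simp add: pol.ev_mult)
  then have "conjugation x (y * z) = pol.ev (f * h) (torsion x) / pol.ev (g * k) (torsion x)"
    by (simp only: conjugation_eq[OF x gk(1)])
  then show "conjugation x (y * z) = conjugation x y * conjugation x z"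
    by (simp add: conj_y conj_z pol.ev_mult)
next
  fix y assume "y \<in> K_rat \<iota>"
  then obtain a b where "b \<noteq> 0" "y = val.ev a \<theta> / val.ev b \<theta>"
    by (auto simp: K_rat_altdef)
  then show "conjugation x y = y"
    using conjugation_eq[OF x, of "[:b:]" "[:a:]"] by simp
qed

lemma Delta_eqI:
  assumes "\<sigma> \<in> carrier \<Delta>" "\<tau> \<in> carrier \<Delta>" "\<sigma> (torsion 1) = \<tau> (torsion 1)"
  shows "\<sigma> = \<tau>"
proof (rule extensionalityI)
  show "\<sigma> \<in> extensional torsion_field" "\<tau> \<in> extensional torsion_field"
    using assms by (auto simp: carrier_Delta Bij_def)
  fix y assume "y \<in> torsion_field"
  then obtain f g where y: "pol.ev g (torsion 1) \<noteq> 0" "y = pol.ev f (torsion 1) / pol.ev g (torsion 1)"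
    by (elim torsion_fieldE)
  have at_y: "\<upsilon> y = pol.ev f (\<upsilon> (torsion 1)) / pol.ev g (\<upsilon> (torsion 1))" if "\<upsilon> \<in> carrier \<Delta>" for \<upsilon>
    unfolding y(2) using that by (intro hom_over_K_value y(1)) (auto simp: carrier_Delta)
  show "\<sigma> y = \<tau> y"
    using at_y[OF assms(1)] at_y[OF assms(2)] assms(3) by simp
qed

text \<open>
  The image of \<open>M(1)\<close> is a root of \<open>torsion_poly\<close>, which already has as many roots \<open>M(x)\<close> as its degree allows.
\<close>

lemma Delta_torsion:
  assumes "\<sigma> \<in> carrier \<Delta>"
  shows "\<sigma> (torsion 1) \<in> torsion ` units"
proof (rule ccontr)
  assume not_conj: "\<sigma> (torsion 1) \<notin> torsion ` units"
  define F where "F = map_poly (\<lambda>a. val.ev a \<theta>) torsion_poly"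
  have "degree F = CARD('q) ^ d - 1"
    unfolding F_def degree_torsion_poly[symmetric] by (rule degree_map_poly) simp
  moreover from this have "F \<noteq> 0"
    using CARD_power_d by auto
  ultimately have "card {y. poly F y = 0} \<le> CARD('q) ^ d - 1"
    using card_poly_roots_bound[of F] by simp
  have F: "poly F y = pol.ev torsion_poly y" for y
    by (simp add: F_def pol.ev_def)
  have "\<sigma> (pol.ev torsion_poly (torsion 1) / pol.ev 1 (torsion 1)) =
        pol.ev torsion_poly (\<sigma> (torsion 1)) / pol.ev 1 (\<sigma> (torsion 1))"
    using assms by (intro hom_over_K_value) (auto simp: carrier_Delta)
  moreover have "\<sigma> 0 = 0"
    using assms value_theta_in_K_rat[of 0] by (simp add: carrier_Delta)
  ultimately have "pol.ev torsion_poly (\<sigma> (torsion 1)) = 0"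
    using torsion_poly_root[OF units_closed(1)] by simp
  then have "insert (\<sigma> (torsion 1)) (torsion ` units) \<subseteq> {y. poly F y = 0}"
    using torsion_poly_root by (auto simp: F)
  then have "card (insert (\<sigma> (torsion 1)) (torsion ` units)) \<le> card {y. poly F y = 0}"
    by (rule card_mono[OF poly_roots_finite[OF \<open>F \<noteq> 0\<close>]])
  moreover have "card (insert (\<sigma> (torsion 1)) (torsion ` units)) = Suc (card units)"
    using not_conj finite_residue_field inj_on_subset[OF inj_on_torsion, of units]
    by (subst card_insert_disjoint) (auto simp: card_image)
  ultimately show False
    using \<open>card {y. poly F y = 0} \<le> CARD('q) ^ d - 1\<close> card_units CARD_power_d by linarith
qed

lemma conjugation_torsion_1: "x \<in> units \<Longrightarrow> conjugation x (torsion 1) = torsion x"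
  using conjugation_torsion[OF _ residue_field_closed(2)] by simp

lemma Delta_eq: "carrier \<Delta> = conjugation ` units"
proof (intro equalityI subsetI)
  fix \<sigma> assume \<sigma>: "\<sigma> \<in> carrier \<Delta>"
  then obtain x where x: "x \<in> units" "\<sigma> (torsion 1) = torsion x"
    using Delta_torsion by blast
  then have "\<sigma> = conjugation x"
    using \<sigma> conjugation_in_Delta conjugation_torsion_1 by (intro Delta_eqI) auto
  with x show "\<sigma> \<in> conjugation ` units"
    by blast
qed (auto intro: conjugation_in_Delta)

lemma conjugation_eq_iff:
  assumes "x \<in> units" "y \<in> units"
  shows "conjugation x = conjugation y \<longleftrightarrow> x = y"
  using assms conjugation_torsion_1 inj_on_torsion by (metis DiffD1 inj_onD)

lemma coprime_prime_iff: "coprime a p \<longleftrightarrow> val.ev a \<zeta> \<noteq> 0"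
proof
  assume "coprime a p"
  then show "val.ev a \<zeta> \<noteq> 0"
    using irred by (auto simp: value_root_eq_0_iff Factorial_Ring.irreducible_def dest: coprime_common_divisor)
next
  assume a: "val.ev a \<zeta> \<noteq> 0"
  show "coprime a p"
  proof (rule coprimeI)
    fix c assume c: "c dvd a" "c dvd p"
    then obtain e where e: "p = c * e" by blast
    have "is_unit c \<or> is_unit e"
      using irred e Factorial_Ring.irreducibleD by blast
    moreover have "\<not> is_unit e"
    proof
      assume "is_unit e"
      then have "p dvd c"
        by (simp add: e)
      then have "p dvd a"
        using c(1) by (rule dvd_trans)
      with a show False
        by (simp add: value_root_eq_0_iff)
    qed
    ultimately show "is_unit c"
      by blast
  qed
qed

lemma sigma_p_eq:
  assumes "coprime a p"
  shows "sigma_p \<iota> \<rho> p a = conjugation (val.ev a \<zeta>)"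
  unfolding sigma_p_def
proof (rule the_equality)
  have x: "val.ev a \<zeta> \<in> units"
    using assms residue_field_closed(8) by (simp add: coprime_prime_iff)
  have lambda: "carlitz_module \<iota> a (lambda_p \<iota> \<rho> p) = torsion (val.ev a \<zeta>)"
    using carlitz_module_torsion[OF residue_field_closed(2), of a] by (simp add: lambda_eq_torsion)
  show conj: "conjugation (val.ev a \<zeta>) \<in> carrier \<Delta> \<and>
        conjugation (val.ev a \<zeta>) (lambda_p \<iota> \<rho> p) = carlitz_module \<iota> a (lambda_p \<iota> \<rho> p)"
    unfolding lambda using x by (simp add: lambda_eq_torsion conjugation_in_Delta conjugation_torsion_1)
  fix \<sigma> assume "\<sigma> \<in> carrier \<Delta> \<and> \<sigma> (lambda_p \<iota> \<rho> p) = carlitz_module \<iota> a (lambda_p \<iota> \<rho> p)"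
  with conj show "\<sigma> = conjugation (val.ev a \<zeta>)"
    by (intro Delta_eqI) (auto simp: lambda_eq_torsion)
qed

lemma teichmueller_conjugation:
  assumes "x \<in> units"
  shows "teichmueller \<iota> \<rho> p \<zeta> (conjugation x) = x"
  unfolding teichmueller_def
proof (rule the_equality)
  obtain a where "x = val.ev a \<zeta>"
    using assms by (auto simp: residue_field_def)
  with assms show "\<exists>a. coprime a p \<and> conjugation x = sigma_p \<iota> \<rho> p a \<and> x = value_at \<iota> a \<zeta>"
    by (intro exI[of _ a]) (auto simp: sigma_p_eq coprime_prime_iff value_at_eq)
next
  fix y assume "\<exists>a. coprime a p \<and> conjugation x = sigma_p \<iota> \<rho> p a \<and> y = value_at \<iota> a \<zeta>"
  then obtain a where a: "coprime a p" "conjugation x = sigma_p \<iota> \<rho> p a" "y = val.ev a \<zeta>"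
    by (auto simp: value_at_eq)
  then have "y \<in> units"
    using residue_field_closed(8) by (simp add: coprime_prime_iff)
  then show "y = x"
    using a assms conjugation_eq_iff by (simp add: sigma_p_eq)
qed

lemma Delta_mult:
  assumes "x \<in> units" "y \<in> units"
  shows "conjugation x \<otimes>\<^bsub>\<Delta>\<^esub> conjugation y = conjugation (x * y)"
proof -
  have Bij: "conjugation x \<in> Bij torsion_field" "conjugation y \<in> Bij torsion_field"
    using assms conjugation_in_Delta by (auto simp: carrier_Delta)
  have "conjugation x \<otimes>\<^bsub>\<Delta>\<^esub> conjugation y = compose torsion_field (conjugation x) (conjugation y)"
    using Bij by (simp add: Delta_eq_galois_group galois_group_def Let_def BijGroup_def)
  also have "\<dots> = conjugation (x * y)"
  proof (rule extensionalityI)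
    show "compose torsion_field (conjugation x) (conjugation y) \<in> extensional torsion_field"
      by (rule compose_extensional)
    show "conjugation (x * y) \<in> extensional torsion_field"
      by (simp add: conjugation_def)
  qed (simp add: compose_eq conjugation_comp[OF assms])
  finally show ?thesis .
qed

lemma Delta_one: "\<one>\<^bsub>\<Delta>\<^esub> = conjugation 1"
proof -
  have "\<one>\<^bsub>\<Delta>\<^esub> = (\<lambda>y\<in>torsion_field. y)"
    by (simp add: Delta_eq_galois_group galois_group_def Let_def BijGroup_def)
  also have "\<dots> = conjugation 1"
  proof (rule extensionalityI)
    show "conjugation 1 \<in> extensional torsion_field"
      by (simp add: conjugation_def)
  qed (auto simp: conjugation_one)
  finally show ?thesis .
qed

lemma Delta_inv:
  assumes x: "x \<in> units"
  shows "inv\<^bsub>\<Delta>\<^esub> conjugation x = conjugation (inverse x)"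
  unfolding m_inv_def
proof (rule the_equality)
  show "conjugation (inverse x) \<in> carrier \<Delta> \<and> conjugation x \<otimes>\<^bsub>\<Delta>\<^esub> conjugation (inverse x) = \<one>\<^bsub>\<Delta>\<^esub> \<and>
        conjugation (inverse x) \<otimes>\<^bsub>\<Delta>\<^esub> conjugation x = \<one>\<^bsub>\<Delta>\<^esub>"
    using x inverse_unit[OF x] by (simp add: Delta_mult Delta_one conjugation_in_Delta)
next
  fix \<sigma> assume \<sigma>: "\<sigma> \<in> carrier \<Delta> \<and> conjugation x \<otimes>\<^bsub>\<Delta>\<^esub> \<sigma> = \<one>\<^bsub>\<Delta>\<^esub> \<and> \<sigma> \<otimes>\<^bsub>\<Delta>\<^esub> conjugation x = \<one>\<^bsub>\<Delta>\<^esub>"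
  then obtain y where y: "y \<in> units" "\<sigma> = conjugation y"
    by (auto simp: Delta_eq)
  with \<sigma> x have "conjugation (x * y) = conjugation 1"
    by (simp add: Delta_mult Delta_one)
  then have "x * y = 1"
    using conjugation_eq_iff units_closed x y(1) by blast
  then show "\<sigma> = conjugation (inverse x)"
    using y(2) inverse_unique by metis
qed

text \<open>
  Parametrised by the units \<open>x\<close>, the Gauss-Thakur sum is the sum evaluated in \<open>torsion_transform\<close>.
\<close>

lemma gauss_thakur_teichmueller:
  assumes "j < d"
  shows "gauss_thakur \<iota> \<rho> p (\<lambda>\<delta>. teichmueller \<iota> \<rho> p \<zeta> \<delta> ^ (CARD('q) ^ j)) =
         inverse (\<delta>\<^sub>p ^ (CARD('q) ^ j)) * omega \<iota> \<rho> (\<zeta> ^ (CARD('q) ^ j))"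
proof -
  have inj: "inj_on conjugation units"
    using conjugation_eq_iff by (intro inj_onI) blast
  have "gauss_thakur \<iota> \<rho> p (\<lambda>\<delta>. teichmueller \<iota> \<rho> p \<zeta> \<delta> ^ (CARD('q) ^ j)) =
        - (\<Sum>x\<in>units. teichmueller \<iota> \<rho> p \<zeta> (inv\<^bsub>\<Delta>\<^esub> conjugation x) ^ (CARD('q) ^ j) * conjugation x (torsion 1))"
    unfolding gauss_thakur_def Delta_eq sum.reindex[OF inj] by (simp add: lambda_eq_torsion)
  also have "\<dots> = - (\<Sum>x\<in>units. inverse x ^ (CARD('q) ^ j) * torsion x)"
  proof (intro arg_cong[of _ _ uminus] sum.cong refl)
    fix x assume x: "x \<in> units"
    show "teichmueller \<iota> \<rho> p \<zeta> (inv\<^bsub>\<Delta>\<^esub> conjugation x) ^ (CARD('q) ^ j) * conjugation x (torsion 1) =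
          inverse x ^ (CARD('q) ^ j) * torsion x"
      by (simp only: Delta_inv[OF x] teichmueller_conjugation[OF inverse_unit[OF x]] conjugation_torsion_1[OF x])
  qed
  finally show ?thesis
    using torsion_transform[OF assms] by simp
qed

end

theorem theorem3:
  fixes \<iota> :: "'q::{field,finite} fls \<Rightarrow> 'c::{field,complete_space}"
    and \<rho> \<zeta> :: 'c and p :: "'q poly" and d j :: nat
  assumes "C_infty \<iota>"
    and "\<rho> ^ (CARD('q) - 1) = - theta \<iota>"
    and "prime_of_A p" and "Polynomial.degree p = d"
    and "\<zeta> \<in> Fq_alg \<iota>" and "value_at \<iota> p \<zeta> = 0"
    and "j \<in> {0..d - 1}"
  shows "gauss_thakur \<iota> \<rho> p (\<lambda>\<delta>. teichmueller \<iota> \<rho> p \<zeta> \<delta> ^ (CARD('q) ^ j)) =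
         value_at \<iota> (pderiv p) \<zeta> powi (- (int CARD('q) ^ j)) * omega \<iota> \<rho> (\<zeta> ^ (CARD('q) ^ j))"
proof -
  interpret C_infty \<iota>
    by fact
  interpret carlitz_prime \<iota> \<rho> p \<zeta>
    using assms by unfold_locales (simp_all add: prime_of_A_def value_at_eq)
  have "j < Polynomial.degree p"
    using assms(4,7) degree_pos by auto
  moreover have "value_at \<iota> (pderiv p) \<zeta> powi (- (int CARD('q) ^ j)) =
      inverse (val.ev (pderiv p) \<zeta> ^ (CARD('q) ^ j))"
    unfolding power_int_minus value_at_eq by (metis of_nat_power power_int_of_nat)
  ultimately show ?thesis
    by (simp add: gauss_thakur_teichmueller)
qed

end
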